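(* Accessible entry-consistent path-fiber transducers can be recognized and reconstructed in polynomial time: there is a polynomial-time algorithm that, given an accessible graph-respecting transducer $T=(Q,q_0,\Omega,S,\Delta,\lambda)$ for a finite self-looping visible graph $(S,E)$, decides whether $T$ is entry-consistent path-fiber and, if so, reconstructs an edge-entry DLSL system whose phase-expanded realization is isomorphic to $T$. The algorithm consists of the fiber inspection (determine for each state whether it is forced-hold or a decision state; check for each $i\in S$ that the fiber hold graph $H_i$ is a directed simple path on all of $\mathrm{Fib}(i)$ whose terminal vertex $p_i$ is the unique decision state of the fiber), augmented with the check that all decision transitions from a fixed source fiber into a fixed successor fiber land in a unique designated entry state.
   Context: Visible graph. $S$ is a finite set (visible states), $E\subseteq S\times S$, $\mathrm{Out}(i)=\{j\in S:(i,j)\in E\}$. A labeling $\ell:S\to\Sigma$ into a finite alphabet makes the graph destination-labeled: edge $(i,j)$ carries label $\ell(j)$. The graph is self-looping if $(i,i)\in E$ for all $i$. It is label-deterministic if for every $i\in S$, $a\in\Sigma$ there is at most one $j\in\mathrm{Out}(i)$ with $\ell(j)=a$. Put $\Sigma_i=\{\ell(j):j\in\mathrm{Out}(i)\}$ and, for $a\in\Sigma_i$, let $\delta(i,a)$ be the unique $j\in\mathrm{Out}(i)$ with $\ell(j)=a$. $\Omega$ is a finite input alphabet. An edge-entry DLSL system is $\mathcal A=(S,E,\ell,s_0,d,\rho,(g_i)_{i\in S})$ where $(S,E,\ell)$ is destination-labeled, self-looping and label-deterministic, $s_0\in S$, $d_i\ge1$ is an integer for each $i$, $g_i:\Omega\to\Sigma_i$,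 and $\rho:E\to\mathbb N$ satisfies $0\le\rho(i,j)\le d_j-1$ for every edge $(i,j)\in E$. Its operational update on input $u\in\Omega$ is $(i,r)\mapsto(i,r-1)$ if $r>0$, and $(i,0)\mapsto(j,\rho(i,j))$ where $j=\delta(i,g_i(u))$. Its phase-expanded realization is the transducer with control states $\{(i,r):i\in S,\ 0\le r\le d_i-1\}$, initial state $(s_0,d_{s_0}-1)$, transitions given by the operational update, and visible labeling $\lambda(i,r)=i$. A graph-respecting (labeled) transducer for $(S,E)$ is a deterministic transducer $T=(Q,q_0,\Omega,S,\Delta,\lambda)$ with $\Delta:Q\times\Omega\to Q$, $Q$ finite, $\lambda:Q\to S$ surjective, and $\lambda(\Delta(q,u))\in\mathrm{Out}(\lambda(q))$ for all $q\in Q,u\in\Omega$. It is accessible if every control state is reached from $q_0$ by some input word. A state $q$ is forced-hold if there is $q'\in Q$ with $\lambda(q')=\lambda(q)$ and $\Delta(q,u)=q'$ for every $u\in\Omega$; then $\mathrm{hsucc}(q):=q'$. Otherwise $q$ is a decision state. For $i\in S$ let $\mathrm{Fib}(i)=\lambda^{-1}(i)$; the fiber hold graph $H_i$ has vertex set $\mathrm{Fib}(i)$ and an edge $q\to\mathrm{hsucc}(q)$ for each forced-hold $q\in\mathrm{Fib}(i)$. $T$ is entry-consistent path-fiber if each $H_i$ is a directed simple path on all of $\mathrm{Fib}(i)$ whose terminal vertex $p_i$ is the unique decision state of the fiber and, for every visible edge $(i,j)\in E$, there is a distinguished entry state $e_{ij}\in\mathrm{Fib}(j)$ such that $\Delta(p_i,u)=e_{ij}$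 whenever $\lambda(\Delta(p_i,u))=j$. Isomorphism of such transducers: a bijection $\Phi$ of control-state sets with $\Phi(\Delta(q,u))=\Delta'(\Phi(q),u)$ and $\lambda'(\Phi(q))=\lambda(q)$ for all $q,u$. *)

theory Defs
  imports "HOL-Computational_Algebra.Polynomial"
begin

section \<open>Visible graphs and graph-respecting transducers\<close>

definition self_looping_graph :: "'s set \<Rightarrow> ('s \<times> 's) set \<Rightarrow> bool" where
  "self_looping_graph S E \<longleftrightarrow> finite S \<and> E \<subseteq> S \<times> S \<and> (\<forall>i\<in>S. (i, i) \<in> E)"

record ('q, 'u, 's) transducer =
  states :: "'q set"
  init :: 'q
  inputs :: "'u set"
  step :: "'q \<Rightarrow> 'u \<Rightarrow> 'q"
  vis :: "'q \<Rightarrow> 's"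

definition graph_respecting ::
  "'s set \<Rightarrow> ('s \<times> 's) set \<Rightarrow> ('q, 'u, 's) transducer \<Rightarrow> bool" where
  "graph_respecting S E T \<longleftrightarrow>
     finite (states T) \<and> finite (inputs T) \<and> init T \<in> states T \<and>
     (\<forall>q\<in>states T. \<forall>u\<in>inputs T. step T q u \<in> states T) \<and>
     vis T ` states T = S \<and>
     (\<forall>q\<in>states T. \<forall>u\<in>inputs T. vis T (step T q u) \<in> E `` {vis T q})"

definition accessible :: "('q, 'u, 's) transducer \<Rightarrow> bool" where
  "accessible T \<longleftrightarrow>
     (\<forall>q\<in>states T. \<exists>us\<in>lists (inputs T). foldl (step T) (init T) us = q)"

definition transducer_iso ::
  "('q, 'u, 's) transducer \<Rightarrow> ('r, 'u, 's) transducer \<Rightarrow> bool" where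
  "transducer_iso T T' \<longleftrightarrow>
     inputs T = inputs T' \<and>
     (\<exists>\<Phi>. bij_betw \<Phi> (states T) (states T') \<and>
          (\<forall>q\<in>states T. \<forall>u\<in>inputs T. \<Phi> (step T q u) = step T' (\<Phi> q) u) \<and>
          (\<forall>q\<in>states T. vis T' (\<Phi> q) = vis T q))"

section \<open>Path fibers\<close>

definition Fib :: "('q, 'u, 's) transducer \<Rightarrow> 's \<Rightarrow> 'q set" where
  "Fib T i = {q \<in> states T. vis T q = i}"

definition holds_to :: "('q, 'u, 's) transducer \<Rightarrow> 'q \<Rightarrow> 'q \<Rightarrow> bool" where
  "holds_to T q q' \<longleftrightarrow>
     q' \<in> states T \<and> vis T q' = vis T q \<and> (\<forall>u\<in>inputs T. step T q u = q')"

definition forced_hold :: "('q, 'u, 's) transducer \<Rightarrow> 'q \<Rightarrow> bool" where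
  "forced_hold T q \<longleftrightarrow> (\<exists>q'. holds_to T q q')"

(* The description is proper whenever the input alphabet is nonempty; over an empty
   alphabet an accessible transducer has a single state, so it is proper there too. *)
definition hsucc :: "('q, 'u, 's) transducer \<Rightarrow> 'q \<Rightarrow> 'q" where
  "hsucc T q = (THE q'. holds_to T q q')"

definition decision :: "('q, 'u, 's) transducer \<Rightarrow> 'q \<Rightarrow> bool" where
  "decision T q \<longleftrightarrow> \<not> forced_hold T q"

definition hold_graph :: "('q, 'u, 's) transducer \<Rightarrow> 's \<Rightarrow> ('q \<times> 'q) set" where
  "hold_graph T i = {(q, hsucc T q) | q. q \<in> Fib T i \<and> forced_hold T q}"

definition simple_path_to :: "'q set \<Rightarrow> ('q \<times> 'q) set \<Rightarrow> 'q \<Rightarrow> bool" where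
  "simple_path_to W H p \<longleftrightarrow>
     (\<exists>xs. xs \<noteq> [] \<and> distinct xs \<and> set xs = W \<and> last xs = p \<and>
           H = {(xs ! k, xs ! Suc k) | k. Suc k < length xs})"

definition path_fiber_at :: "('q, 'u, 's) transducer \<Rightarrow> 's \<Rightarrow> 'q \<Rightarrow> bool" where
  "path_fiber_at T i p \<longleftrightarrow>
     simple_path_to (Fib T i) (hold_graph T i) p \<and> {q \<in> Fib T i. decision T q} = {p}"

definition entry_consistent_path_fiber ::
  "'s set \<Rightarrow> ('s \<times> 's) set \<Rightarrow> ('q, 'u, 's) transducer \<Rightarrow> bool" where
  "entry_consistent_path_fiber S E T \<longleftrightarrow>
     (\<exists>p. (\<forall>i\<in>S. path_fiber_at T i (p i)) \<and>
          (\<forall>(i, j)\<in>E. \<exists>e\<in>Fib T j.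
             \<forall>u\<in>inputs T. vis T (step T (p i) u) = j \<longrightarrow> step T (p i) u = e))"

text \<open>The two tests that make up the algorithm.\<close>

definition passes_fiber_inspection :: "'s set \<Rightarrow> ('q, 'u, 's) transducer \<Rightarrow> bool" where
  "passes_fiber_inspection S T \<longleftrightarrow> (\<forall>i\<in>S. \<exists>p. path_fiber_at T i p)"

definition passes_entry_check :: "('s \<times> 's) set \<Rightarrow> ('q, 'u, 's) transducer \<Rightarrow> bool" where
  "passes_entry_check E T \<longleftrightarrow>
     (\<forall>(i, j)\<in>E. \<exists>e\<in>Fib T j. \<forall>q\<in>Fib T i. decision T q \<longrightarrow>
        (\<forall>u\<in>inputs T. vis T (step T q u) = j \<longrightarrow> step T q u = e))"

section \<open>Edge-entry DLSL systems\<close>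

record ('s, 'l, 'u) dlsl =
  verts :: "'s set"
  edges :: "('s \<times> 's) set"
  label :: "'s \<Rightarrow> 'l"
  start :: 's
  dwell :: "'s \<Rightarrow> nat"
  entry :: "'s \<Rightarrow> 's \<Rightarrow> nat"
  choice :: "'s \<Rightarrow> 'u \<Rightarrow> 'l"

definition label_deterministic :: "'s set \<Rightarrow> ('s \<times> 's) set \<Rightarrow> ('s \<Rightarrow> 'l) \<Rightarrow> bool" where
  "label_deterministic S E lab \<longleftrightarrow>
     (\<forall>i\<in>S. \<forall>j\<in>E `` {i}. \<forall>j'\<in>E `` {i}. lab j = lab j' \<longrightarrow> j = j')"

definition edge_entry_dlsl :: "'u set \<Rightarrow> ('s, 'l, 'u) dlsl \<Rightarrow> bool" where
  "edge_entry_dlsl U A \<longleftrightarrow>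
     self_looping_graph (verts A) (edges A) \<and>
     label_deterministic (verts A) (edges A) (label A) \<and>
     start A \<in> verts A \<and>
     (\<forall>i\<in>verts A. 1 \<le> dwell A i) \<and>
     (\<forall>i\<in>verts A. \<forall>u\<in>U. choice A i u \<in> label A ` (edges A `` {i})) \<and>
     (\<forall>(i, j)\<in>edges A. entry A i j \<le> dwell A j - 1)"

definition dest :: "('s, 'l, 'u) dlsl \<Rightarrow> 's \<Rightarrow> 'l \<Rightarrow> 's" where
  "dest A i a = (THE j. j \<in> edges A `` {i} \<and> label A j = a)"

fun update :: "('s, 'l, 'u) dlsl \<Rightarrow> 's \<times> nat \<Rightarrow> 'u \<Rightarrow> 's \<times> nat" where
  "update A (i, r) u =
     (if r > 0 then (i, r - 1)
      else (let j = dest A i (choice A i u) in (j, entry A i j)))"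

definition realization :: "'u set \<Rightarrow> ('s, 'l, 'u) dlsl \<Rightarrow> ('s \<times> nat, 'u, 's) transducer" where
  "realization U A =
     \<lparr> states = {(i, r). i \<in> verts A \<and> r \<le> dwell A i - 1},
       init = (start A, dwell A (start A) - 1),
       inputs = U,
       step = update A,
       vis = fst \<rparr>"

section \<open>A random-access machine with structured control\<close>

text \<open>
  Programs act on registers and arrays of natural numbers and are charged one unit per
  executed assignment, test or skip. The only arithmetic is addition and truncated
  subtraction, so a step lengthens the binary representation of the largest stored number by at
  most a constant depending on the program. Hence polynomially many steps are polynomial time
  in the sense of Turing machines (multiplication at unit cost would break this).
\<close>

datatype aexp =
    Const nat
  | Reg nat
  | Arr nat aexp
  | Plus aexp aexp
  | Minus aexp aexp

datatype bexp =
    Eq aexp aexp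
  | Less aexp aexp
  | Neg bexp
  | Conj bexp bexp

datatype com =
    Skip
  | SetReg nat aexp
  | SetArr nat aexp aexp
  | Seq com com
  | Cond bexp com com
  | While bexp com

type_synonym store = "(nat \<Rightarrow> nat) \<times> (nat \<Rightarrow> nat \<Rightarrow> nat)"

fun aval :: "aexp \<Rightarrow> store \<Rightarrow> nat" where
  "aval (Const c) s = c"
| "aval (Reg x) s = fst s x"
| "aval (Arr a e) s = snd s a (aval e s)"
| "aval (Plus e f) s = aval e s + aval f s"
| "aval (Minus e f) s = aval e s - aval f s"

fun bval :: "bexp \<Rightarrow> store \<Rightarrow> bool" where
  "bval (Eq e f) s \<longleftrightarrow> aval e s = aval f s"
| "bval (Less e f) s \<longleftrightarrow> aval e s < aval f s"
| "bval (Neg b) s \<longleftrightarrow> \<not> bval b s"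
| "bval (Conj b c) s \<longleftrightarrow> bval b s \<and> bval c s"

inductive exec :: "com \<Rightarrow> store \<Rightarrow> nat \<Rightarrow> store \<Rightarrow> bool" where
  Skip: "exec Skip s 1 s"
| SetReg: "exec (SetReg x e) (r, m) 1 (r(x := aval e (r, m)), m)"
| SetArr: "exec (SetArr a e f) (r, m) 1
             (r, m(a := (m a)(aval e (r, m) := aval f (r, m))))"
| Seq: "exec c s t s' \<Longrightarrow> exec d s' t' s'' \<Longrightarrow> exec (Seq c d) s (t + t') s''"
| CondTrue: "bval b s \<Longrightarrow> exec c s t s' \<Longrightarrow> exec (Cond b c d) s (t + 1) s'"
| CondFalse: "\<not> bval b s \<Longrightarrow> exec d s t s' \<Longrightarrow> exec (Cond b c d) s (t + 1) s'"
| WhileFalse: "\<not> bval b s \<Longrightarrow> exec (While b c) s 1 s"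
| WhileTrue: "bval b s \<Longrightarrow> exec c s t s' \<Longrightarrow> exec (While b c) s' t' s'' \<Longrightarrow>
                exec (While b c) s (t + t' + 1) s''"

inductive_cases SkipE: "exec Skip s t s'"
inductive_cases SetRegE: "exec (SetReg x e) s t s'"
inductive_cases SetArrE: "exec (SetArr a e f) s t s'"
inductive_cases SeqE: "exec (Seq c d) s t s'"
inductive_cases CondE: "exec (Cond b c d) s t s'"
inductive_cases WhileE: "exec (While b c) s t s'"

lemma exec_deterministic:
  "exec c s t s' \<Longrightarrow> exec c s u s'' \<Longrightarrow> u = t \<and> s'' = s'"
proof (induction arbitrary: u s'' rule: exec.induct)
  case Skip
  then show ?case by (elim SkipE) simp
next
  case SetReg
  then show ?case by (elim SetRegE) simp
next
  case SetArr
  then show ?case by (elim SetArrE) simp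
next
  case (Seq c s t s' d t' s3)
  from Seq.prems obtain t1 s1 t2 where *: "u = t1 + t2" "exec c s t1 s1" "exec d s1 t2 s''"
    by (elim SeqE)
  show ?case using Seq.IH(1)[OF *(2)] Seq.IH(2)[of t2 s''] * by simp
next
  case (CondTrue b s c t s' d)
  from CondTrue.prems CondTrue.hyps(1)
  obtain t1 where *: "u = t1 + 1" "exec c s t1 s''" by (elim CondE) simp_all
  show ?case using CondTrue.IH[OF *(2)] * by simp
next
  case (CondFalse b s d t s' c)
  from CondFalse.prems CondFalse.hyps(1)
  obtain t1 where *: "u = t1 + 1" "exec d s t1 s''" by (elim CondE) simp_all
  show ?case using CondFalse.IH[OF *(2)] * by simp
next
  case (WhileFalse b s c)
  from WhileFalse.prems WhileFalse.hyps show ?case by (cases rule: WhileE) auto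
next
  case (WhileTrue b s c t s' t' s3)
  from WhileTrue.prems WhileTrue.hyps(1)
  obtain t1 s1 t2 where *: "u = t1 + t2 + 1" "exec c s t1 s1" "exec (While b c) s1 t2 s''"
    by (cases rule: WhileE) auto
  show ?case using WhileTrue.IH(1)[OF *(2)] WhileTrue.IH(2)[of t2 s''] * by simp
qed

text \<open>Words are passed in and out through array 0, with their length in register 0.\<close>

definition input_store :: "nat list \<Rightarrow> store" where
  "input_store w =
     ((\<lambda>x. if x = 0 then length w else 0),
      (\<lambda>a i. if a = 0 \<and> i < length w then w ! i else 0))"

definition output_word :: "store \<Rightarrow> nat list" where
  "output_word s = map (snd s 0) [0..<fst s 0]"

text \<open>
  A test reports its verdict in register 1 (1 for pass, 0 for fail), and the fiber inspection
  leaves its classification of the control states in array 1.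
\<close>

definition verdict :: "store \<Rightarrow> nat" where
  "verdict s = fst s 1"

definition classification :: "store \<Rightarrow> nat \<Rightarrow> nat" where
  "classification s q = snd s 1 q"

definition reject :: com where
  "reject = Seq (SetArr 0 (Const 0) (Const 0)) (SetReg 0 (Const 1))"

definition recognizer :: "com \<Rightarrow> com \<Rightarrow> com \<Rightarrow> com" where
  "recognizer inspect check build =
     Seq inspect
       (Cond (Eq (Reg 1) (Const 1))
         (Seq check (Cond (Eq (Reg 1) (Const 1)) build reject))
         reject)"

section \<open>Encodings\<close>

definition table :: "nat \<Rightarrow> nat \<Rightarrow> (nat \<Rightarrow> nat \<Rightarrow> nat) \<Rightarrow> nat list" where
  "table a b f = concat (map (\<lambda>i. map (f i) [0..<b]) [0..<a])"

definition encode_instance ::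
  "nat \<Rightarrow> nat \<Rightarrow> nat \<Rightarrow> (nat \<times> nat) set \<Rightarrow> (nat, nat, nat) transducer \<Rightarrow> nat list" where
  "encode_instance k n m E T =
     [k, n, m, init T] @ map (vis T) [0..<n] @ table n m (step T) @
     table k k (\<lambda>i j. if (i, j) \<in> E then 1 else 0)"

definition encode_dlsl :: "nat \<Rightarrow> nat \<Rightarrow> (nat, nat, nat) dlsl \<Rightarrow> nat list" where
  "encode_dlsl k m A =
     [k, m, start A] @ map (label A) [0..<k] @ map (dwell A) [0..<k] @
     table k k (\<lambda>i j. if (i, j) \<in> edges A then 1 else 0) @
     table k k (\<lambda>i j. if (i, j) \<in> edges A then entry A i j else 0) @
     table k m (choice A)"

lemma length_table [simp]: "length (table a b f) = a * b"
  by (simp add: table_def length_concat o_def sum_list_triv)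

text \<open>
  No letter of an input word exceeds the length of the word, so that length is, up to a
  polynomial, the size of the instance in binary or unary notation alike.
\<close>

lemma encode_instance_le_length:
  assumes "graph_respecting {..<k} E T" "states T = {..<n}" "inputs T = {..<m}"
    and "x \<in> set (encode_instance k n m E T)"
  shows "x \<le> length (encode_instance k n m E T)"
proof -
  have T: "init T < n" "\<And>q u. q < n \<Longrightarrow> u < m \<Longrightarrow> step T q u < n" "\<And>q. q < n \<Longrightarrow> vis T q < k"
    using assms(1-3) by (auto simp: graph_respecting_def)
  have L: "length (encode_instance k n m E T) = 4 + n + n * m + k * k"
    by (simp add: encode_instance_def)
  have "x \<le> k \<or> x \<le> n \<or> x \<le> m \<or> x \<le> 1"
    using assms(4) T[THEN less_imp_le]
    by (auto simp: encode_instance_def table_def split: if_splits)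
  moreover have "k \<le> k * k" "m \<le> n * m"
    using T(1) by auto
  ultimately show ?thesis
    using L by linarith
qed

end

theory Submission
  imports Defs
begin

text \<open>
  In a path fiber the number of hold steps from a control state to the decision state, its rank,
  determines the state. Conversely a fiber is a path as soon as every walk along hold steps
  reaches a decision state and the ranks in the fiber are pairwise distinct: the ranks form a
  downward closed set of numbers, and hold steps lower them by one. Both conditions are tested
  by following \<open>n\<close> hold steps from every state. Mapping \<open>q\<close> to the pair of its visible state
  and its rank is then the isomorphism onto the phase-expanded realization of the system whose
  dwell times are the sizes of the fibers, whose entry phases are the ranks of the entry states
  and whose labels are the visible states themselves.
\<close>

section \<open>Timed weakest preconditions\<close>

text \<open>Time is tracked by a polynomial read off the program text, valid whenever every loop
  makes at most \<open>L\<close> iterations, where \<open>L\<close> is the argument of the polynomial.\<close>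

fun cost :: "com \<Rightarrow> nat poly" where
  "cost Skip = 1"
| "cost (SetReg x e) = 1"
| "cost (SetArr a e f) = 1"
| "cost (Seq c d) = cost c + cost d"
| "cost (Cond b c d) = cost c + cost d + 1"
| "cost (While b c) = 1 + [:0, 1:] * (cost c + 1)"

definition wp :: "nat \<Rightarrow> com \<Rightarrow> (store \<Rightarrow> bool) \<Rightarrow> store \<Rightarrow> bool" where
  "wp L c Q s \<longleftrightarrow> (\<exists>t s'. exec c s t s' \<and> t \<le> poly (cost c) L \<and> Q s')"

definition set_reg :: "nat \<Rightarrow> nat \<Rightarrow> store \<Rightarrow> store" where
  "set_reg x v s = ((fst s)(x := v), snd s)"

definition set_arr :: "nat \<Rightarrow> nat \<Rightarrow> nat \<Rightarrow> store \<Rightarrow> store" where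
  "set_arr a i v s = (fst s, (snd s)(a := (snd s a)(i := v)))"

lemma store_update_simps [simp]:
  "fst (set_reg x v s) = (fst s)(x := v)"
  "snd (set_reg x v s) = snd s"
  "fst (set_arr a i v s) = fst s"
  "snd (set_arr a i v s) = (snd s)(a := (snd s a)(i := v))"
  by (simp_all add: set_reg_def set_arr_def)

lemma wp_mono: "wp L c Q s \<Longrightarrow> (\<And>s'. Q s' \<Longrightarrow> Q' s') \<Longrightarrow> wp L c Q' s"
  unfolding wp_def by blast

lemma wp_Skip: "Q s \<Longrightarrow> wp L Skip Q s"
  using exec.Skip[of s] unfolding wp_def by (intro exI[of _ 1] exI[of _ s]) simp

lemma wp_SetReg: "Q (set_reg x (aval e s) s) \<Longrightarrow> wp L (SetReg x e) Q s"
  using exec.SetReg[of x e "fst s" "snd s"] unfolding wp_def set_reg_def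
  by (intro exI[of _ 1] exI[of _ "((fst s)(x := aval e s), snd s)"]) simp

lemma wp_SetArr: "Q (set_arr a (aval e s) (aval f s) s) \<Longrightarrow> wp L (SetArr a e f) Q s"
  using exec.SetArr[of a e f "fst s" "snd s"] unfolding wp_def set_arr_def
  by (intro exI[of _ 1] exI[of _ "(fst s, (snd s)(a := (snd s a)(aval e s := aval f s)))"]) simp

lemma wp_Seq: "wp L c (wp L d Q) s \<Longrightarrow> wp L (Seq c d) Q s"
  unfolding wp_def by (fastforce intro: exec.Seq add_mono)

lemma wp_Seq_mono: "wp L c R s \<Longrightarrow> (\<And>s'. R s' \<Longrightarrow> wp L d Q s') \<Longrightarrow> wp L (Seq c d) Q s"
  by (blast intro: wp_Seq wp_mono)

lemma wp_Cond:
  assumes "bval b s \<Longrightarrow> wp L c Q s" "\<not> bval b s \<Longrightarrow> wp L d Q s"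
  shows "wp L (Cond b c d) Q s"
proof (cases "bval b s")
  case True
  with assms(1) obtain t s' where "exec c s t s'" "t \<le> poly (cost c) L" "Q s'"
    unfolding wp_def by blast
  with True show ?thesis
    unfolding wp_def by (intro exI[of _ "t + 1"] exI[of _ s']) (simp add: exec.CondTrue[simplified])
next
  case False
  with assms(2) obtain t s' where "exec d s t s'" "t \<le> poly (cost d) L" "Q s'"
    unfolding wp_def by blast
  with False show ?thesis
    unfolding wp_def by (intro exI[of _ "t + 1"] exI[of _ s']) (simp add: exec.CondFalse[simplified])
qed

lemmas wp_intros = wp_Skip wp_SetReg wp_SetArr wp_Seq wp_Cond

definition For :: "nat \<Rightarrow> nat \<Rightarrow> com \<Rightarrow> com" where
  "For x y c = Seq (SetReg x (Const 0))
     (While (Less (Reg x) (Reg y)) (Seq c (SetReg x (Plus (Reg x) (Const 1)))))"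

lemma wp_For:
  assumes "x \<noteq> y" and "fst s y = N" and "N \<le> L" and "I 0 (set_reg x 0 s)"
    and body: "\<And>i s. i < N \<Longrightarrow> I i s \<Longrightarrow> fst s x = i \<Longrightarrow> fst s y = N \<Longrightarrow>
      wp L c (\<lambda>s'. fst s' x = i \<and> fst s' y = N \<and> I (Suc i) (set_reg x (Suc i) s')) s"
    and post: "\<And>s. I N s \<Longrightarrow> Q s"
  shows "wp L (For x y c) Q s"
proof -
  let ?b = "Less (Reg x) (Reg y)"
  let ?c = "Seq c (SetReg x (Plus (Reg x) (Const 1)))"
  let ?C = "poly (cost ?c) L"
  have loop: "\<exists>t s'. exec (While ?b ?c) s t s' \<and> t \<le> j * (?C + 1) + 1 \<and> Q s'"
    if "I (N - j) s" "fst s x = N - j" "fst s y = N" "j \<le> N" for j s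
    using that
  proof (induction j arbitrary: s)
    case 0
    then have "exec (While ?b ?c) s 1 s" by (intro exec.WhileFalse) simp
    with 0 post show ?case by (intro exI[of _ 1] exI[of _ s]) simp
  next
    case (Suc j)
    then have "wp L c (\<lambda>s'. fst s' x = N - Suc j \<and> fst s' y = N \<and>
        I (Suc (N - Suc j)) (set_reg x (Suc (N - Suc j)) s')) s"
      by (intro body) auto
    moreover have "Suc (N - Suc j) = N - j" using Suc.prems by simp
    ultimately have "wp L c (wp L (SetReg x (Plus (Reg x) (Const 1)))
        (\<lambda>s'. fst s' x = N - j \<and> fst s' y = N \<and> I (N - j) s')) s"
      using \<open>x \<noteq> y\<close> by (elim wp_mono) (auto intro!: wp_SetReg)
    then have "wp L ?c (\<lambda>s'. fst s' x = N - j \<and> fst s' y = N \<and> I (N - j) s') s"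
      by (rule wp_Seq)
    then obtain t s1 where 1: "exec ?c s t s1" "t \<le> ?C" "fst s1 x = N - j" "fst s1 y = N"
      "I (N - j) s1" unfolding wp_def by blast
    from Suc.IH[OF 1(5,3,4)] Suc.prems obtain t' s2 where
      2: "exec (While ?b ?c) s1 t' s2" "t' \<le> j * (?C + 1) + 1" "Q s2" by auto
    have "exec (While ?b ?c) s (t + t' + 1) s2"
      using 1 2 Suc.prems by (intro exec.WhileTrue) auto
    with 1 2 show ?case by (intro exI[of _ "t + t' + 1"] exI[of _ s2]) simp
  qed
  have "wp L (While ?b ?c) Q (set_reg x 0 s)"
  proof -
    obtain t s' where "exec (While ?b ?c) (set_reg x 0 s) t s'" "t \<le> N * (?C + 1) + 1" "Q s'"
      using loop[of N "set_reg x 0 s"] assms(1,2,4) by auto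
    moreover have "N * (?C + 1) + 1 \<le> poly (cost (While ?b ?c)) L"
      using mult_right_mono[OF \<open>N \<le> L\<close>, of "?C + 1"] by simp
    ultimately show ?thesis unfolding wp_def by (meson le_trans)
  qed
  then show ?thesis unfolding For_def by (auto intro!: wp_Seq wp_SetReg)
qed

section \<open>Words and output\<close>

lemma table_Suc: "table (Suc a) b f = table a b f @ map (f a) [0..<b]"
  by (simp add: table_def)

lemma table_0 [simp]: "table 0 b f = []"
  by (simp add: table_def)

lemma table_cong: "(\<And>i j. i < a \<Longrightarrow> j < b \<Longrightarrow> f i j = g i j) \<Longrightarrow> table a b f = table a b g"
  by (auto simp: table_def intro!: arg_cong[of _ _ concat])

lemma row_index_less:
  fixes i j :: nat
  assumes "i < a" "j < b"
  shows "i * b + j < a * b"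
proof -
  have "i * b + j < Suc i * b" using assms by simp
  also have "\<dots> \<le> a * b" using assms by (intro mult_right_mono) auto
  finally show ?thesis .
qed

lemma nth_table: "i < a \<Longrightarrow> j < b \<Longrightarrow> table a b f ! (i * b + j) = f i j"
proof (induction a)
  case (Suc a)
  show ?case
  proof (cases "i < a")
    case True
    with Suc row_index_less[OF True Suc.prems(2)] show ?thesis
      by (simp add: table_Suc nth_append)
  next
    case False
    with Suc.prems have "i = a" by simp
    with Suc.prems show ?thesis by (simp add: table_Suc nth_append)
  qed
qed simp

definition emit :: "aexp \<Rightarrow> com" where
  "emit e = Seq (SetArr 0 (Reg 0) e) (SetReg 0 (Plus (Reg 0) (Const 1)))"

lemma output_word_set_reg [simp]: "x \<noteq> 0 \<Longrightarrow> output_word (set_reg x v s) = output_word s"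
  by (simp add: output_word_def)

lemma output_word_emit [simp]:
  "output_word (set_reg 0 (Suc (fst s 0)) (set_arr 0 (fst s 0) v s)) = output_word s @ [v]"
  by (auto simp: output_word_def)

lemma wp_emit:
  assumes "Q (set_reg 0 (Suc (fst s 0)) (set_arr 0 (fst s 0) (aval e s) s))"
  shows "wp L (emit e) Q s"
  using assms unfolding emit_def by (auto intro!: wp_intros)

section \<open>The programs\<close>

text \<open>Registers 2, 3, 4 hold \<open>k\<close>, \<open>n\<close>, \<open>m\<close>. Array 2 is a copy of the input; arrays 3
  and 4 hold the addresses in it of the rows of the transition table and of the adjacency matrix,
  as the machine cannot multiply. Array 1 classifies the control states, array 5 holds their
  distance to the decision state and array 6 the decision state of each fiber.\<close>

definition vis_at :: "aexp \<Rightarrow> aexp" where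
  "vis_at e = Arr 2 (Plus (Const 4) e)"

definition step_at :: "aexp \<Rightarrow> aexp \<Rightarrow> aexp" where
  "step_at e f = Arr 2 (Plus (Arr 3 e) f)"

definition edge_at :: "aexp \<Rightarrow> aexp \<Rightarrow> aexp" where
  "edge_at e f = Arr 2 (Plus (Arr 4 e) f)"

definition copy_input :: com where
  "copy_input = For 5 0 (SetArr 2 (Reg 5) (Arr 0 (Reg 5)))"

definition read_header :: com where
  "read_header = Seq (SetReg 2 (Arr 2 (Const 0))) (Seq (SetReg 3 (Arr 2 (Const 1)))
     (Seq (SetReg 4 (Arr 2 (Const 2))) (SetReg 12 (Plus (Const 4) (Reg 3)))))"

definition row_addresses :: "nat \<Rightarrow> nat \<Rightarrow> nat \<Rightarrow> com" where
  "row_addresses a y z =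
     For 5 y (Seq (SetArr a (Reg 5) (Reg 12)) (SetReg 12 (Plus (Reg 12) (Reg z))))"

definition decode :: com where
  "decode = Seq copy_input (Seq read_header (Seq (row_addresses 3 3 4) (row_addresses 4 2 2)))"

definition classify_state :: com where
  "classify_state = Seq (SetArr 1 (Reg 5) (Const 1))
     (For 6 4 (Cond (Conj (Eq (step_at (Reg 5) (Reg 6)) (step_at (Reg 5) (Const 0)))
                          (Eq (vis_at (step_at (Reg 5) (Reg 6))) (vis_at (Reg 5))))
        Skip (SetArr 1 (Reg 5) (Const 0))))"

definition classify :: com where
  "classify = For 5 3 classify_state"

definition walk_step :: com where
  "walk_step = Cond (Eq (Arr 1 (Reg 10)) (Const 1))
     (Seq (SetReg 10 (step_at (Reg 10) (Const 0)))
       (SetArr 5 (Reg 5) (Plus (Arr 5 (Reg 5)) (Const 1))))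
     Skip"

definition walk :: com where
  "walk = Seq (SetReg 10 (Reg 5)) (Seq (SetArr 5 (Reg 5) (Const 0)) (Seq (For 6 3 walk_step)
     (Cond (Eq (Arr 1 (Reg 10)) (Const 1)) (SetReg 1 (Const 0)) Skip)))"

definition compare_ranks :: com where
  "compare_ranks = For 5 3 (For 6 3
     (Cond (Conj (Neg (Eq (Reg 5) (Reg 6))) (Conj (Eq (vis_at (Reg 5)) (vis_at (Reg 6)))
             (Eq (Arr 5 (Reg 5)) (Arr 5 (Reg 6)))))
        (SetReg 1 (Const 0)) Skip))"

definition inspect :: com where
  "inspect = Seq decode (Seq classify (Cond (Less (Const 0) (Reg 4))
     (Seq (SetReg 1 (Const 1)) (Seq (For 5 3 walk) compare_ranks))
     (SetReg 1 (Const 0))))"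

definition check_pair :: com where
  "check_pair = Cond (Conj (Eq (Arr 1 (Reg 5)) (Const 0))
       (Conj (Eq (vis_at (step_at (Reg 5) (Reg 6))) (vis_at (step_at (Reg 5) (Reg 7))))
         (Neg (Eq (step_at (Reg 5) (Reg 6)) (step_at (Reg 5) (Reg 7))))))
     (SetReg 1 (Const 0)) Skip"

definition check :: com where
  "check = For 5 3 (For 6 4 (For 7 4 check_pair))"

definition find_decisions :: com where
  "find_decisions = For 5 3 (Cond (Eq (Arr 1 (Reg 5)) (Const 0))
     (SetArr 6 (vis_at (Reg 5)) (Reg 5)) Skip)"

definition emit_dwell :: com where
  "emit_dwell = Seq (SetReg 11 (Const 0)) (Seq
     (For 6 3 (Cond (Eq (vis_at (Reg 6)) (Reg 5))
        (SetReg 11 (Plus (Reg 11) (Const 1))) Skip))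
     (emit (Reg 11)))"

definition emit_entry :: com where
  "emit_entry = Seq (SetReg 11 (Const 0)) (Seq
     (For 7 4 (Cond (Eq (vis_at (step_at (Arr 6 (Reg 5)) (Reg 7))) (Reg 6))
        (SetReg 11 (Arr 5 (step_at (Arr 6 (Reg 5)) (Reg 7)))) Skip))
     (emit (Reg 11)))"

definition build :: com where
  "build = Seq find_decisions (Seq (SetReg 0 (Const 0)) (Seq (emit (Const 1))
     (Seq (emit (Reg 2)) (Seq (emit (Reg 4)) (Seq (emit (vis_at (Arr 2 (Const 3))))
     (Seq (For 5 2 (emit (Reg 5)))
     (Seq (For 5 2 emit_dwell)
     (Seq (For 5 2 (For 6 2 (emit (edge_at (Reg 5) (Reg 6)))))
     (Seq (For 5 2 (For 6 2 emit_entry))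
       (For 5 2 (For 6 4 (emit (vis_at (step_at (Arr 6 (Reg 5)) (Reg 6)))))))))))))))"

section \<open>Path fibers through ranks\<close>

lemma transducer_iso_sym:
  assumes "transducer_iso T T'"
    and closed: "\<And>q u. q \<in> states T \<Longrightarrow> u \<in> inputs T \<Longrightarrow> step T q u \<in> states T"
  shows "transducer_iso T' T"
proof -
  obtain \<Phi> where \<Phi>: "bij_betw \<Phi> (states T) (states T')"
      "\<And>q u. q \<in> states T \<Longrightarrow> u \<in> inputs T \<Longrightarrow> \<Phi> (step T q u) = step T' (\<Phi> q) u"
      "\<And>q. q \<in> states T \<Longrightarrow> vis T' (\<Phi> q) = vis T q" and inputs: "inputs T = inputs T'"
    using assms(1) unfolding transducer_iso_def by blast
  let ?\<Psi> = "inv_into (states T) \<Phi>"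
  have \<Psi>: "?\<Psi> q' \<in> states T" "\<Phi> (?\<Psi> q') = q'" if "q' \<in> states T'" for q'
    using that \<Phi>(1) by (auto simp: bij_betw_def inv_into_into f_inv_into_f)
  have "?\<Psi> (step T' q' u) = step T (?\<Psi> q') u" if "q' \<in> states T'" "u \<in> inputs T'" for q' u
  proof -
    have "step T (?\<Psi> q') u \<in> states T" "step T' q' u = \<Phi> (step T (?\<Psi> q') u)"
      using \<Psi>[OF that(1)] \<Phi>(2)[of "?\<Psi> q'" u] that(2) inputs closed by auto
    then show ?thesis using bij_betw_inv_into_left[OF \<Phi>(1)] by simp
  qed
  moreover have "vis T (?\<Psi> q') = vis T' q'" if "q' \<in> states T'" for q'
    using \<Phi>(3)[of "?\<Psi> q'"] \<Psi>[OF that] by simp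
  ultimately show ?thesis
    using inputs bij_betw_inv_into[OF \<Phi>(1)] unfolding transducer_iso_def by auto
qed

lemma downward_closed_eq_lessThan:
  fixes X :: "nat set"
  assumes "finite X" and "\<And>r. Suc r \<in> X \<Longrightarrow> r \<in> X"
  shows "X = {..<card X}"
proof (cases "X = {}")
  case False
  have "Max X - j \<in> X" for j
  proof (induction j)
    case (Suc j)
    then show ?case using assms(2)[of "Max X - Suc j"]
      by (cases "j < Max X") (auto simp: Suc_diff_Suc)
  qed (use assms(1) False in simp)
  then have "r \<in> X" if "r \<le> Max X" for r
    using that by (metis diff_diff_cancel)
  then have "X = {..Max X}"
    using assms(1) by auto
  then show ?thesis
    by (metis card_atMost lessThan_Suc_atMost)
qed simp

locale respecting =
  fixes k n m :: nat and E :: "(nat \<times> nat) set" and T :: "(nat, nat, nat) transducer"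
  assumes looping: "self_looping_graph {..<k} E"
    and respects: "graph_respecting {..<k} E T"
    and states_eq [simp]: "states T = {..<n}"
    and inputs_eq [simp]: "inputs T = {..<m}"
begin

lemma init_less [simp]: "init T < n"
  and step_less [simp]: "q < n \<Longrightarrow> u < m \<Longrightarrow> step T q u < n"
  and vis_less [simp]: "q < n \<Longrightarrow> vis T q < k"
  and vis_onto: "vis T ` {..<n} = {..<k}"
  and vis_step: "q < n \<Longrightarrow> u < m \<Longrightarrow> (vis T q, vis T (step T q u)) \<in> E"
  using respects by (auto simp: graph_respecting_def)

lemma mem_Fib_iff: "q \<in> Fib T i \<longleftrightarrow> q < n \<and> vis T q = i"
  by (auto simp: Fib_def)

lemma finite_Fib [simp]: "finite (Fib T i)"
  by (simp add: Fib_def)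

lemma Fib_nonempty: "i < k \<Longrightarrow> \<exists>q. q \<in> Fib T i"
  using vis_onto by (metis imageE lessThan_iff mem_Fib_iff)

lemma edges_subset: "E \<subseteq> {..<k} \<times> {..<k}"
  using looping by (simp add: self_looping_graph_def)

lemma forced_hold_iff:
  assumes "q < n"
  shows "forced_hold T q \<longleftrightarrow> (\<forall>u<m. step T q u = step T q 0 \<and> vis T (step T q u) = vis T q)"
proof (cases "m = 0")
  case True
  with assms show ?thesis by (auto simp: forced_hold_def holds_to_def)
next
  case False
  show ?thesis
  proof
    assume "forced_hold T q"
    then obtain q' where "vis T q' = vis T q" "\<And>u. u < m \<Longrightarrow> step T q u = q'"
      by (auto simp: forced_hold_def holds_to_def)
    with False show "\<forall>u<m. step T q u = step T q 0 \<and> vis T (step T q u) = vis T q" by simp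
  next
    assume *: "\<forall>u<m. step T q u = step T q 0 \<and> vis T (step T q u) = vis T q"
    have "step T q 0 < n" using False assms by simp
    with False * have "holds_to T q (step T q 0)"
      unfolding holds_to_def inputs_eq states_eq Ball_def lessThan_iff by blast
    then show "forced_hold T q" by (auto simp: forced_hold_def)
  qed
qed

lemma hsucc_eq: "0 < m \<Longrightarrow> q < n \<Longrightarrow> forced_hold T q \<Longrightarrow> hsucc T q = step T q 0"
  unfolding hsucc_def forced_hold_def holds_to_def by (intro the_equality) auto

lemma not_fiber_inspection_if_no_inputs:
  assumes "m = 0"
  shows "\<not> passes_fiber_inspection {..<k} T"
proof
  assume *: "passes_fiber_inspection {..<k} T"
  have "vis T (init T) \<in> {..<k}" by simp
  with * obtain p where "{q \<in> Fib T (vis T (init T)). decision T q} = {p}"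
    unfolding passes_fiber_inspection_def path_fiber_at_def by blast
  then have "p < n" "\<not> forced_hold T p"
    by (auto simp: decision_def mem_Fib_iff)
  with assms show False by (simp add: forced_hold_iff)
qed

text \<open>Applying \<open>hold\<close> to a state walks along its fiber and stops at a decision state;
  \<open>n\<close> steps suffice unless the walk is periodic.\<close>

definition hold :: "nat \<Rightarrow> nat" where
  "hold q = (if forced_hold T q then step T q 0 else q)"

definition rank :: "nat \<Rightarrow> nat" where
  "rank q = (\<Sum>j<n. if forced_hold T ((hold ^^ j) q) then 1 else 0)"

definition halting :: bool where
  "halting \<longleftrightarrow> (\<forall>q<n. \<not> forced_hold T ((hold ^^ n) q))"

definition ranks_distinct :: bool where
  "ranks_distinct \<longleftrightarrow>
     (\<forall>q<n. \<forall>q'<n. \<not> (q \<noteq> q' \<and> vis T q = vis T q' \<and> rank q = rank q'))"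

lemma hold_less: "0 < m \<Longrightarrow> q < n \<Longrightarrow> hold q < n"
  by (simp add: hold_def)

lemma hold_funpow_less: "0 < m \<Longrightarrow> q < n \<Longrightarrow> (hold ^^ j) q < n"
  by (induction j) (simp_all add: hold_less)

lemma vis_hold: "0 < m \<Longrightarrow> q < n \<Longrightarrow> vis T (hold q) = vis T q"
  using forced_hold_iff[of q] unfolding hold_def by metis

lemma hold_funpow_decision: "\<not> forced_hold T q \<Longrightarrow> (hold ^^ j) q = q"
  by (induction j) (simp_all add: hold_def)

lemma rank_decision: "\<not> forced_hold T q \<Longrightarrow> rank q = 0"
  by (simp add: rank_def hold_funpow_decision)

lemma rank_forced:
  assumes "halting" "q < n" "forced_hold T q"
  shows "rank q = Suc (rank (hold q))"
proof -
  obtain n' where n': "n = Suc n'" using \<open>q < n\<close> by (cases n) auto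
  have "\<not> forced_hold T ((hold ^^ n) q)"
    using assms by (simp add: halting_def)
  then have "\<not> forced_hold T ((hold ^^ Suc n') q)"
    unfolding n' .
  define f where "f j = (if forced_hold T ((hold ^^ j) q) then 1 else 0 :: nat)" for j
  have "rank q = sum f {..<n}"
    by (simp add: rank_def f_def)
  also have "\<dots> = sum f {..<Suc n'}"
    by (simp only: n')
  also have "\<dots> = f 0 + (\<Sum>j<n'. f (Suc j))"
    by (rule sum.lessThan_Suc_shift)
  also have "\<dots> = Suc (\<Sum>j<Suc n'. f (Suc j))"
    using assms(3) \<open>\<not> forced_hold T ((hold ^^ Suc n') q)\<close> by (simp add: f_def)
  also have "(\<Sum>j<Suc n'. f (Suc j)) = (\<Sum>j<n. f (Suc j))"
    by (simp only: n')
  also have "\<dots> = rank (hold q)"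
    unfolding rank_def f_def funpow_Suc_right o_apply ..
  finally show ?thesis .
qed

lemma rank_eq_0_iff: "halting \<Longrightarrow> q < n \<Longrightarrow> rank q = 0 \<longleftrightarrow> \<not> forced_hold T q"
  by (metis rank_decision rank_forced nat.distinct(1))

lemma rank_image_Fib:
  assumes "0 < m" halting ranks_distinct
  shows "rank ` Fib T i = {..<card (Fib T i)}" and "inj_on rank (Fib T i)"
proof -
  show inj: "inj_on rank (Fib T i)"
    using assms(3) unfolding ranks_distinct_def by (intro inj_onI) (metis mem_Fib_iff)
  have "r \<in> rank ` Fib T i" if "Suc r \<in> rank ` Fib T i" for r
  proof -
    from that obtain q where q: "q < n" "vis T q = i" "rank q = Suc r"
      by (metis imageE mem_Fib_iff)
    then have "forced_hold T q" by (metis rank_decision nat.distinct(1))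
    with q have "rank (hold q) = r" using rank_forced assms(2) by fastforce
    moreover have "hold q \<in> Fib T i"
      using q assms(1) by (simp add: mem_Fib_iff hold_less vis_hold)
    ultimately show ?thesis by blast
  qed
  then have "rank ` Fib T i = {..<card (rank ` Fib T i)}"
    by (intro downward_closed_eq_lessThan) auto
  then show "rank ` Fib T i = {..<card (Fib T i)}"
    by (simp add: card_image[OF inj])
qed

lemma path_fiber_at_if_ranks:
  assumes "0 < m" halting ranks_distinct "i < k"
  shows "\<exists>p. path_fiber_at T i p"
proof -
  let ?W = "Fib T i"
  define d where "d = card ?W"
  define g where "g = inv_into ?W rank"
  define xs where "xs = map g (rev [0..<d])"
  have inj: "inj_on rank ?W" and im: "rank ` ?W = {..<d}"
    using rank_image_Fib[OF assms(1-3)] by (auto simp: d_def)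
  have "0 < d"
    using Fib_nonempty[OF \<open>i < k\<close>] by (auto simp: d_def card_gt_0_iff)
  have g: "g r \<in> ?W" "rank (g r) = r" if "r < d" for r
    using that im by (auto simp: g_def inv_into_into f_inv_into_f)
  have g_rank: "g (rank q) = q" "rank q < d" if "q \<in> ?W" for q
    using that inj im by (auto simp: g_def)
  have nth: "xs ! a = g (d - Suc a)" if "a < d" for a
    using that by (simp add: xs_def rev_nth)
  have hold: "hsucc T q = g (rank q - 1)" "0 < rank q" if "q \<in> ?W" "forced_hold T q" for q
  proof -
    have q: "q < n" "vis T q = i" using that(1) by (auto simp: mem_Fib_iff)
    then have "hold q \<in> ?W" using assms(1) by (simp add: mem_Fib_iff hold_less vis_hold)
    moreover have "rank q = Suc (rank (hold q))" using rank_forced assms(2) q that(2) by blast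
    moreover have "hsucc T q = hold q"
      using hsucc_eq assms(1) q that(2) by (simp add: hold_def)
    ultimately show "hsucc T q = g (rank q - 1)" "0 < rank q" using g_rank by auto
  qed
  have "hold_graph T i = {(xs ! a, xs ! Suc a) | a. Suc a < length xs}" (is "_ = ?R")
  proof (intro equalityI subsetI)
    fix e assume "e \<in> hold_graph T i"
    then obtain q where q: "e = (q, hsucc T q)" "q \<in> ?W" "forced_hold T q"
      by (auto simp: hold_graph_def)
    let ?a = "d - Suc (rank q)"
    have "rank q < d" "0 < rank q" using g_rank hold q by auto
    then have "Suc ?a < d" "d - Suc ?a = rank q" "d - Suc (Suc ?a) = rank q - 1" by auto
    then have "xs ! ?a = q" "xs ! Suc ?a = hsucc T q" "Suc ?a < length xs"
      using q g_rank hold by (simp_all add: nth xs_def[THEN arg_cong[of _ _ length]])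
    with q(1) show "e \<in> ?R" by force
  next
    fix e assume "e \<in> ?R"
    then obtain a where a: "e = (xs ! a, xs ! Suc a)" "Suc a < d" by (auto simp: xs_def)
    let ?q = "xs ! a"
    have q: "?q \<in> ?W" "rank ?q = d - Suc a" using a g by (auto simp: nth)
    then have "forced_hold T ?q" using a rank_decision[of ?q] by fastforce
    with q a hold[of ?q] show "e \<in> hold_graph T i" by (auto simp: hold_graph_def nth)
  qed
  moreover have "distinct xs"
    using g(2) by (auto simp: xs_def distinct_map intro!: inj_on_inverseI[of _ rank])
  moreover have "set xs = ?W"
    using g g_rank by (force simp: xs_def)
  moreover have "xs \<noteq> []" "last xs = g 0"
    using \<open>0 < d\<close> by (simp_all add: xs_def last_map last_rev)
  ultimately have "simple_path_to ?W (hold_graph T i) (g 0)"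
    unfolding simple_path_to_def by blast
  moreover have "{q \<in> ?W. decision T q} = {g 0}"
  proof -
    have "decision T q \<longleftrightarrow> q = g 0" if "q \<in> ?W" for q
      using that rank_eq_0_iff[OF assms(2)] g g_rank \<open>0 < d\<close>
      by (metis decision_def mem_Fib_iff)
    then show ?thesis using g \<open>0 < d\<close> by auto
  qed
  ultimately show ?thesis unfolding path_fiber_at_def by blast
qed

lemma rank_on_path_fiber:
  assumes "0 < m" and "path_fiber_at T i p"
  shows "inj_on rank (Fib T i)"
    and "\<And>q. q \<in> Fib T i \<Longrightarrow> \<not> forced_hold T ((hold ^^ n) q)"
proof -
  obtain xs where xs: "distinct xs" "set xs = Fib T i" "last xs = p" "xs \<noteq> []"
      "hold_graph T i = {(xs ! a, xs ! Suc a) | a. Suc a < length xs}"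
    and dec: "{q \<in> Fib T i. decision T q} = {p}"
    using assms(2) unfolding path_fiber_at_def simple_path_to_def by blast
  let ?l = "length xs"
  have p: "p = xs ! (?l - 1)" using xs by (simp add: last_conv_nth)
  have mem: "xs ! a \<in> Fib T i" if "a < ?l" for a using xs that by auto
  have forced: "forced_hold T (xs ! a) \<longleftrightarrow> Suc a < ?l" if "a < ?l" for a
  proof -
    have "forced_hold T (xs ! a) \<longleftrightarrow> xs ! a \<noteq> p"
      using dec mem[OF that] by (auto simp: decision_def)
    also have "\<dots> \<longleftrightarrow> Suc a < ?l"
      using that xs(1) by (auto simp: p nth_eq_iff_index_eq)
    finally show ?thesis .
  qed
  have hold_nth: "hold (xs ! a) = xs ! min (Suc a) (?l - 1)" if "a < ?l" for a
  proof (cases "Suc a < ?l")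
    case True
    then have f: "forced_hold T (xs ! a)" using forced that by blast
    then have "(xs ! a, hsucc T (xs ! a)) \<in> hold_graph T i"
      using mem[OF that] by (auto simp: hold_graph_def)
    then obtain b where "xs ! a = xs ! b" "hsucc T (xs ! a) = xs ! Suc b" "Suc b < ?l"
      using xs(5) by auto
    then have "hsucc T (xs ! a) = xs ! Suc a"
      using xs(1) that by (metis nth_eq_iff_index_eq Suc_lessD)
    moreover have "min (Suc a) (?l - 1) = Suc a" using True by simp
    ultimately show ?thesis
      using f hsucc_eq[OF assms(1)] mem[OF that] by (simp add: hold_def mem_Fib_iff)
  next
    case False
    then have "min (Suc a) (?l - 1) = a" using that by simp
    then show ?thesis using False forced that by (simp add: hold_def)
  qed
  have funpow: "(hold ^^ j) (xs ! a) = xs ! min (a + j) (?l - 1)" if "a < ?l" for a j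
  proof (induction j)
    case 0
    have "min a (?l - 1) = a" using that by linarith
    then show ?case by simp
  next
    case (Suc j)
    have "min (a + j) (?l - 1) < ?l" using that by auto
    moreover have "min (Suc (min (a + j) (?l - 1))) (?l - 1) = min (a + Suc j) (?l - 1)"
      by simp
    ultimately show ?case using hold_nth Suc by simp
  qed
  have "?l \<le> n"
    using distinct_card[OF xs(1)] xs(2) card_mono[of "{..<n}" "Fib T i"] by (auto simp: Fib_def)
  have rank: "rank (xs ! a) = ?l - 1 - a" if "a < ?l" for a
  proof -
    have "rank (xs ! a) = (\<Sum>j<n. if j < ?l - 1 - a then 1 else 0)"
      unfolding rank_def
    proof (intro sum.cong refl if_cong)
      fix j
      have "min (a + j) (?l - 1) < ?l" using that by auto
      from forced[OF this] show "forced_hold T ((hold ^^ j) (xs ! a)) \<longleftrightarrow> j < ?l - 1 - a"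
        using that by (auto simp: funpow)
    qed
    also have "\<dots> = card ({..<n} \<inter> {j. j < ?l - 1 - a})"
      by (simp add: sum.If_cases)
    also have "{..<n} \<inter> {j. j < ?l - 1 - a} = {..<?l - 1 - a}"
      using \<open>?l \<le> n\<close> by auto
    finally show ?thesis by simp
  qed
  show "inj_on rank (Fib T i)"
  proof (rule inj_onI)
    fix q q' assume "q \<in> Fib T i" "q' \<in> Fib T i" and eq: "rank q = rank q'"
    then obtain a b where "a < ?l" "q = xs ! a" "b < ?l" "q' = xs ! b"
      using xs(2) by (metis in_set_conv_nth)
    with eq rank[of a] rank[of b] have "?l - 1 - a = ?l - 1 - b" by metis
    with \<open>a < ?l\<close> \<open>b < ?l\<close> have "a = b" by linarith
    with \<open>q = xs ! a\<close> \<open>q' = xs ! b\<close> show "q = q'" by simp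
  qed
  show "\<not> forced_hold T ((hold ^^ n) q)" if q: "q \<in> Fib T i" for q
  proof -
    obtain a where a: "a < ?l" "q = xs ! a"
      using xs(2) q by (metis in_set_conv_nth)
    have "min (a + n) (?l - 1) = ?l - 1" using \<open>?l \<le> n\<close> by linarith
    then have "(hold ^^ n) q = xs ! (?l - 1)" using a by (simp add: funpow)
    with forced[of "?l - 1"] a show ?thesis by simp
  qed
qed

lemma passes_fiber_inspection_iff:
  assumes "0 < m"
  shows "passes_fiber_inspection {..<k} T \<longleftrightarrow> halting \<and> ranks_distinct"
proof
  assume *: "passes_fiber_inspection {..<k} T"
  show "halting \<and> ranks_distinct"
    unfolding halting_def ranks_distinct_def
  proof (intro conjI allI impI notI)
    fix q assume "q < n"
    then obtain p where "path_fiber_at T (vis T q) p"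
      using * unfolding passes_fiber_inspection_def by (meson lessThan_iff vis_less)
    from rank_on_path_fiber(2)[OF assms this, of q] \<open>q < n\<close>
    show "forced_hold T ((hold ^^ n) q) \<Longrightarrow> False" by (simp add: mem_Fib_iff)
  next
    fix q q' assume q: "q < n" "q' < n" "q \<noteq> q' \<and> vis T q = vis T q' \<and> rank q = rank q'"
    then obtain p where "path_fiber_at T (vis T q) p"
      using * unfolding passes_fiber_inspection_def by (meson lessThan_iff vis_less)
    from rank_on_path_fiber(1)[OF assms this] q show False
      by (auto simp: mem_Fib_iff dest: inj_onD)
  qed
next
  assume "halting \<and> ranks_distinct"
  with assms path_fiber_at_if_ranks show "passes_fiber_inspection {..<k} T"
    by (simp add: passes_fiber_inspection_def)
qed

lemma passes_entry_check_iff: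
  assumes "passes_fiber_inspection {..<k} T"
  shows "passes_entry_check E T \<longleftrightarrow>
    (\<forall>q<n. \<forall>u<m. \<forall>v<m. \<not> (\<not> forced_hold T q \<and> vis T (step T q u) = vis T (step T q v) \<and>
       step T q u \<noteq> step T q v))" (is "_ \<longleftrightarrow> ?C")
proof
  assume *: "passes_entry_check E T"
  have "step T q u = step T q v"
    if q: "q < n" "u < m" "v < m" "\<not> forced_hold T q"
      "vis T (step T q u) = vis T (step T q v)" for q u v
  proof -
    obtain e where "\<forall>q'\<in>Fib T (vis T q). decision T q' \<longrightarrow>
        (\<forall>w\<in>inputs T. vis T (step T q' w) = vis T (step T q u) \<longrightarrow> step T q' w = e)"
      using * vis_step[OF q(1,2)] unfolding passes_entry_check_def by blast
    then have e: "vis T (step T q w) = vis T (step T q u) \<Longrightarrow> step T q w = e" if "w < m" for w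
      using q(1,4) that by (auto simp: mem_Fib_iff decision_def)
    show ?thesis using e[OF q(2)] e[OF q(3)] q(5) by simp
  qed
  then show ?C by blast
next
  assume C: ?C
  show "passes_entry_check E T"
    unfolding passes_entry_check_def
  proof safe
    fix i j assume ij: "(i, j) \<in> E"
    then have "i < k" "j < k" using edges_subset by auto
    obtain p where "path_fiber_at T i p"
      using assms \<open>i < k\<close> by (auto simp: passes_fiber_inspection_def)
    then have dec: "{q \<in> Fib T i. decision T q} = {p}"
      by (simp add: path_fiber_at_def)
    then have p: "p < n" "\<not> forced_hold T p"
      by (auto simp: decision_def mem_Fib_iff)
    have "\<exists>e\<in>Fib T j. \<forall>u<m. vis T (step T p u) = j \<longrightarrow> step T p u = e"
    proof (cases "\<exists>u<m. vis T (step T p u) = j")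
      case True
      then obtain u where "u < m" "vis T (step T p u) = j" by blast
      with p C show ?thesis by (intro bexI[of _ "step T p u"]) (auto simp: mem_Fib_iff)
    next
      case False
      then show ?thesis using Fib_nonempty[OF \<open>j < k\<close>] by blast
    qed
    with dec show "\<exists>e\<in>Fib T j. \<forall>q\<in>Fib T i. decision T q \<longrightarrow>
        (\<forall>u\<in>inputs T. vis T (step T q u) = j \<longrightarrow> step T q u = e)"
      by (metis (no_types, lifting) inputs_eq lessThan_iff mem_Collect_eq singletonD)
  qed
qed

lemma entry_consistent_path_fiber_iff:
  "entry_consistent_path_fiber {..<k} E T \<longleftrightarrow>
     passes_fiber_inspection {..<k} T \<and> passes_entry_check E T"
proof
  assume "entry_consistent_path_fiber {..<k} E T"
  then obtain p where p: "\<forall>i\<in>{..<k}. path_fiber_at T i (p i)"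
    and e: "\<forall>(i, j)\<in>E. \<exists>e\<in>Fib T j.
      \<forall>u\<in>inputs T. vis T (step T (p i) u) = j \<longrightarrow> step T (p i) u = e"
    unfolding entry_consistent_path_fiber_def by blast
  have "q = p i" if "i < k" "q \<in> Fib T i" "decision T q" for q i
    using p that by (auto simp: path_fiber_at_def)
  moreover have "i < k" if "(i, j) \<in> E" for i j
    using that edges_subset by blast
  ultimately have eq: "q = p i" if "(i, j) \<in> E" "q \<in> Fib T i" "decision T q" for q i j
    using that by blast
  have "passes_entry_check E T"
    unfolding passes_entry_check_def
  proof (intro ballI, clarify)
    fix i j assume ij: "(i, j) \<in> E"
    from bspec[OF e this] obtain e' where "e' \<in> Fib T j"
      "\<forall>u\<in>inputs T. vis T (step T (p i) u) = j \<longrightarrow> step T (p i) u = e'" by blast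
    with eq[OF ij] show "\<exists>e\<in>Fib T j. \<forall>q\<in>Fib T i. decision T q \<longrightarrow>
        (\<forall>u\<in>inputs T. vis T (step T q u) = j \<longrightarrow> step T q u = e)"
      by (intro bexI[of _ e']) auto
  qed
  with p show "passes_fiber_inspection {..<k} T \<and> passes_entry_check E T"
    unfolding passes_fiber_inspection_def by blast
next
  assume *: "passes_fiber_inspection {..<k} T \<and> passes_entry_check E T"
  then obtain p where p: "\<forall>i\<in>{..<k}. path_fiber_at T i (p i)"
    unfolding passes_fiber_inspection_def by metis
  then have "p i \<in> Fib T i \<and> decision T (p i)" if "i < k" for i
    using that by (auto simp: path_fiber_at_def)
  moreover have "i < k" if "(i, j) \<in> E" for i j
    using that edges_subset by blast
  ultimately have mem: "p i \<in> Fib T i" "decision T (p i)" if "(i, j) \<in> E" for i j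
    using that by blast+
  have "\<forall>(i, j)\<in>E. \<exists>e\<in>Fib T j.
      \<forall>u\<in>inputs T. vis T (step T (p i) u) = j \<longrightarrow> step T (p i) u = e"
  proof (intro ballI, clarify)
    fix i j assume ij: "(i, j) \<in> E"
    from * obtain e where "e \<in> Fib T j" "\<forall>q\<in>Fib T i. decision T q \<longrightarrow>
        (\<forall>u\<in>inputs T. vis T (step T q u) = j \<longrightarrow> step T q u = e)"
      using ij unfolding passes_entry_check_def by blast
    with mem[OF ij] show "\<exists>e\<in>Fib T j.
        \<forall>u\<in>inputs T. vis T (step T (p i) u) = j \<longrightarrow> step T (p i) u = e"
      by (intro bexI[of _ e]) blast
  qed
  with p show "entry_consistent_path_fiber {..<k} E T"
    unfolding entry_consistent_path_fiber_def by blast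
qed

section \<open>Correctness of the programs\<close>

abbreviation word :: "nat list" where
  "word \<equiv> encode_instance k n m E T"

lemma length_word: "length word = 4 + n + n * m + k * k"
  by (simp add: encode_instance_def)

lemma bounds: "n \<le> length word" "m \<le> length word" "k \<le> length word"
proof -
  have "0 < n" using init_less by (rule order.strict_trans1[rotated]) simp
  then have "m \<le> n * m" by simp
  then show "n \<le> length word" "m \<le> length word" "k \<le> length word"
    using le_square[of k] unfolding length_word by linarith+
qed

lemma nth_word:
  "word ! 0 = k" "word ! 1 = n" "word ! 2 = m" "word ! 3 = init T"
  "q < n \<Longrightarrow> word ! (4 + q) = vis T q"
  "q < n \<Longrightarrow> u < m \<Longrightarrow> word ! (4 + n + q * m + u) = step T q u"
  "i < k \<Longrightarrow> j < k \<Longrightarrow> word ! (4 + n + n * m + i * k + j) = (if (i, j) \<in> E then 1 else 0)"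
proof -
  let ?A = "[k, n, m, init T]" and ?B = "map (vis T) [0..<n]" and ?C = "table n m (step T)"
    and ?D = "table k k (\<lambda>i j. if (i, j) \<in> E then 1 else 0)"
  have word: "word = ?A @ ?B @ ?C @ ?D" by (simp add: encode_instance_def)
  show "word ! 0 = k" "word ! 1 = n" "word ! 2 = m" "word ! 3 = init T"
    by (simp_all add: word numeral_2_eq_2 numeral_3_eq_3)
  show "word ! (4 + q) = vis T q" if "q < n"
    using that by (simp add: word nth_append)
  show "word ! (4 + n + q * m + u) = step T q u" if "q < n" "u < m"
  proof -
    have "word ! (4 + n + q * m + u) = (?C @ ?D) ! (q * m + u)"
      unfolding word using nth_append_length_plus[of "?A @ ?B" "?C @ ?D" "q * m + u"]
      by (simp add: add.assoc)
    then show ?thesis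
      using row_index_less[OF that] nth_table[OF that] by (simp add: nth_append)
  qed
  show "word ! (4 + n + n * m + i * k + j) = (if (i, j) \<in> E then 1 else 0)" if "i < k" "j < k"
  proof -
    have "word ! (4 + n + n * m + i * k + j) = ?D ! (i * k + j)"
      unfolding word using nth_append_length_plus[of "?A @ ?B @ ?C" "?D" "i * k + j"]
      by (simp add: add.assoc)
    then show ?thesis using nth_table[OF that] by simp
  qed
qed

definition decoded :: "store \<Rightarrow> bool" where
  "decoded s \<longleftrightarrow> fst s 2 = k \<and> fst s 3 = n \<and> fst s 4 = m \<and> snd s 2 3 = init T \<and>
     (\<forall>q<n. snd s 2 (4 + q) = vis T q) \<and>
     (\<forall>q<n. \<forall>u<m. snd s 2 (snd s 3 q + u) = step T q u) \<and>
     (\<forall>i<k. \<forall>j<k. snd s 2 (snd s 4 i + j) = (if (i, j) \<in> E then 1 else 0))"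

definition classified :: "store \<Rightarrow> bool" where
  "classified s \<longleftrightarrow> (\<forall>q<n. snd s 1 q = (if forced_hold T q then 1 else 0))"

definition ranked :: "store \<Rightarrow> bool" where
  "ranked s \<longleftrightarrow> (\<forall>q<n. snd s 5 q = rank q)"

lemma store_predicates_update [simp]:
  "x \<notin> {2, 3, 4} \<Longrightarrow> decoded (set_reg x v s) = decoded s"
  "a \<notin> {2, 3, 4} \<Longrightarrow> decoded (set_arr a j v s) = decoded s"
  "classified (set_reg x v s) = classified s"
  "a \<noteq> 1 \<Longrightarrow> classified (set_arr a j v s) = classified s"
  "ranked (set_reg x v s) = ranked s"
  "a \<noteq> 5 \<Longrightarrow> ranked (set_arr a j v s) = ranked s"
  by (auto simp: decoded_def classified_def ranked_def)

lemma decoded_regs: "decoded s \<Longrightarrow> fst s 2 = k" "decoded s \<Longrightarrow> fst s 3 = n" "decoded s \<Longrightarrow> fst s 4 = m"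
  by (auto simp: decoded_def)

lemma decoded_aval [simp]:
  "decoded s \<Longrightarrow> aval e s < n \<Longrightarrow> aval (vis_at e) s = vis T (aval e s)"
  "decoded s \<Longrightarrow> aval e s < n \<Longrightarrow> aval f s < m \<Longrightarrow>
     aval (step_at e f) s = step T (aval e s) (aval f s)"
  "decoded s \<Longrightarrow> aval e s < k \<Longrightarrow> aval f s < k \<Longrightarrow>
     aval (edge_at e f) s = (if (aval e s, aval f s) \<in> E then 1 else 0)"
  by (simp_all add: decoded_def vis_at_def step_at_def edge_at_def)

lemma wp_decode: "wp (length word) decode decoded (input_store word)"
proof -
  let ?L = "length word"
  define copied where "copied s \<longleftrightarrow> (\<forall>j<?L. snd s 2 j = word ! j)" for s :: store
  define header where "header s \<longleftrightarrow> copied s \<and> fst s 2 = k \<and> fst s 3 = n \<and> fst s 4 = m" for s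
  have [simp]: "copied (set_reg x v s) = copied s" "a \<noteq> 2 \<Longrightarrow> copied (set_arr a j v s) = copied s"
    for x v s a j by (simp_all add: copied_def)
  have [simp]: "x \<notin> {2, 3, 4} \<Longrightarrow> header (set_reg x v s) = header s"
    "a \<noteq> 2 \<Longrightarrow> header (set_arr a j v s) = header s" for x v s a j
    by (simp_all add: header_def)
  define steps where "steps i s \<longleftrightarrow> (\<forall>q<i. snd s 3 q = 4 + n + q * m)" for i and s :: store
  define rows where "rows i s \<longleftrightarrow> (\<forall>j<i. snd s 4 j = 4 + n + n * m + j * k)" for i and s :: store
  have 1: "wp ?L copy_input copied (input_store word)"
    unfolding copy_input_def
    by (rule wp_For[where N = ?L and I = "\<lambda>i s. fst s 0 = ?L \<and> (\<forall>j<?L. snd s 0 j = word ! j) \<and>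
        (\<forall>j<i. snd s 2 j = word ! j)"])
      (auto simp: input_store_def copied_def less_Suc_eq intro!: wp_intros)
  have 2: "wp ?L read_header (\<lambda>s. header s \<and> fst s 12 = 4 + n) s" if "copied s" for s
  proof -
    have "snd s 2 0 = k" "snd s 2 1 = n" "snd s 2 2 = m"
      using that nth_word(1-3) unfolding copied_def length_word by auto
    with that show ?thesis
      unfolding read_header_def by (auto simp: header_def intro!: wp_intros)
  qed
  have 3: "wp ?L (row_addresses 3 3 4) (\<lambda>s. header s \<and> steps n s \<and> fst s 12 = 4 + n + n * m) s"
    if "header s" "fst s 12 = 4 + n" for s
    unfolding row_addresses_def
    by (rule wp_For[where N = n and I = "\<lambda>i s. header s \<and> steps i s \<and> fst s 12 = 4 + n + i * m"])
      (use that bounds in \<open>auto simp: header_def steps_def less_Suc_eq intro!: wp_intros\<close>)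
  have 4: "wp ?L (row_addresses 4 2 2) (\<lambda>s. header s \<and> steps n s \<and> rows k s) s"
    if "header s" "steps n s" "fst s 12 = 4 + n + n * m" for s
    unfolding row_addresses_def
    by (rule wp_For[where N = k and I = "\<lambda>i s. header s \<and> steps n s \<and> rows i s \<and>
        fst s 12 = 4 + n + n * m + i * k"])
      (use that bounds in \<open>auto simp: header_def steps_def rows_def less_Suc_eq intro!: wp_intros\<close>)
  have 5: "decoded s" if "header s" "steps n s" "rows k s" for s
  proof -
    have s: "snd s 2 j = word ! j" if "j < ?L" for j
      using \<open>header s\<close> that by (simp add: header_def copied_def)
    have "snd s 2 3 = init T" using s[of 3] nth_word(4) by (simp add: length_word)
    moreover have "snd s 2 (4 + q) = vis T q" if "q < n" for q
      using s[of "4 + q"] nth_word(5)[OF that] that by (simp add: length_word)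
    moreover have "snd s 2 (snd s 3 q + u) = step T q u" if "q < n" "u < m" for q u
      using s[of "4 + n + q * m + u"] nth_word(6)[OF that] row_index_less[OF that] that \<open>steps n s\<close>
      by (simp add: length_word steps_def)
    moreover have "snd s 2 (snd s 4 i + j) = (if (i, j) \<in> E then 1 else 0)" if "i < k" "j < k" for i j
      using s[of "4 + n + n * m + i * k + j"] nth_word(7)[OF that] row_index_less[OF that] that
        \<open>rows k s\<close> by (simp add: length_word rows_def)
    ultimately show ?thesis using \<open>header s\<close> unfolding decoded_def header_def by blast
  qed
  show ?thesis
    unfolding decode_def
    by (intro wp_Seq wp_mono[OF 1] wp_mono[OF 2] wp_mono[OF 3] wp_mono[OF 4] 5) auto
qed

definition stays :: "nat \<Rightarrow> nat \<Rightarrow> bool" where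
  "stays q u \<longleftrightarrow> step T q u = step T q 0 \<and> vis T (step T q u) = vis T q"

lemma forced_hold_iff_stays: "q < n \<Longrightarrow> forced_hold T q \<longleftrightarrow> (\<forall>u<m. stays q u)"
  unfolding stays_def by (rule forced_hold_iff)

lemma wp_classify_state:
  assumes "decoded s" "fst s 5 = i" "i < n"
  shows "wp (length word) classify_state (\<lambda>s'. decoded s' \<and> fst s' 5 = i \<and>
    snd s' 1 = (snd s 1)(i := if forced_hold T i then 1 else 0)) s"
  unfolding classify_state_def
proof (rule wp_Seq, rule wp_SetArr,
    rule wp_For[where N = m and I = "\<lambda>u s'. decoded s' \<and> fst s' 5 = i \<and>
      snd s' 1 = (snd s 1)(i := if \<forall>v<u. stays i v then 1 else 0)"])
  fix u s'
  assume "u < m" "decoded s' \<and> fst s' 5 = i \<and>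
      snd s' 1 = (snd s 1)(i := if \<forall>v<u. stays i v then 1 else 0)" "fst s' 6 = u" "fst s' 4 = m"
  with \<open>i < n\<close> show "wp (length word) (Cond (Conj (Eq (step_at (Reg 5) (Reg 6)) (step_at (Reg 5) (Const 0)))
            (Eq (vis_at (step_at (Reg 5) (Reg 6))) (vis_at (Reg 5))))
          Skip (SetArr 1 (Reg 5) (Const 0)))
     (\<lambda>s'. fst s' 6 = u \<and> fst s' 4 = m \<and> decoded (set_reg 6 (Suc u) s') \<and>
        fst (set_reg 6 (Suc u) s') 5 = i \<and> snd (set_reg 6 (Suc u) s') 1 =
          (snd s 1)(i := if \<forall>v<Suc u. stays i v then 1 else 0)) s'"
    by (intro wp_intros) (auto simp: All_less_Suc stays_def[of i u])
next
  fix s' assume "decoded s' \<and> fst s' 5 = i \<and>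
      snd s' 1 = (snd s 1)(i := if \<forall>v<m. stays i v then 1 else 0)"
  then show "decoded s' \<and> fst s' 5 = i \<and>
      snd s' 1 = (snd s 1)(i := if forced_hold T i then 1 else 0)"
    using \<open>i < n\<close> by (simp add: forced_hold_iff_stays)
qed (use assms bounds in \<open>auto simp: decoded_regs\<close>)

lemma wp_classify:
  assumes "decoded s"
  shows "wp (length word) classify (\<lambda>s. decoded s \<and> classified s) s"
  unfolding classify_def
proof (rule wp_For[where N = n and
      I = "\<lambda>i s. decoded s \<and> (\<forall>q<i. snd s 1 q = (if forced_hold T q then 1 else 0))"])
  fix i s
  assume "i < n" "decoded s \<and> (\<forall>q<i. snd s 1 q = (if forced_hold T q then 1 else 0))" "fst s 5 = i"
  then show "wp (length word) classify_state (\<lambda>s'. fst s' 5 = i \<and> fst s' 3 = n \<and>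
      decoded (set_reg 5 (Suc i) s') \<and>
      (\<forall>q<Suc i. snd (set_reg 5 (Suc i) s') 1 q = (if forced_hold T q then 1 else 0))) s"
    by (intro wp_mono[OF wp_classify_state[of s i]])
      (auto simp: decoded_regs less_Suc_eq simp del: fun_upd_apply, auto)
qed (use assms bounds in \<open>auto simp: decoded_regs classified_def\<close>)

lemma wp_For_flag:
  assumes "x \<noteq> y" "x \<noteq> 1" "fst s y = N" "N \<le> L" "J s"
    and J: "\<And>s v. J (set_reg x v s) = J s"
    and body: "\<And>i s. i < N \<Longrightarrow> J s \<Longrightarrow> fst s x = i \<Longrightarrow> fst s y = N \<Longrightarrow>
      wp L c (\<lambda>s'. fst s' x = i \<and> fst s' y = N \<and> J s' \<and>
        fst s' 1 = (if P i then fst s 1 else 0)) s"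
    and post: "\<And>s'. J s' \<Longrightarrow> fst s' 1 = (if \<forall>i<N. P i then fst s 1 else 0) \<Longrightarrow> Q s'"
  shows "wp L (For x y c) Q s"
proof (rule wp_For[where I = "\<lambda>i s'. J s' \<and> fst s' 1 = (if \<forall>l<i. P l then fst s 1 else 0)"])
  fix i s'
  assume "i < N" "J s' \<and> fst s' 1 = (if \<forall>l<i. P l then fst s 1 else 0)" "fst s' x = i" "fst s' y = N"
  then show "wp L c (\<lambda>s''. fst s'' x = i \<and> fst s'' y = N \<and> J (set_reg x (Suc i) s'') \<and>
      fst (set_reg x (Suc i) s'') 1 = (if \<forall>l<Suc i. P l then fst s 1 else 0)) s'"
    using J \<open>x \<noteq> 1\<close> by (intro wp_mono[OF body]) (auto simp: All_less_Suc)
qed (use assms in auto)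
lemma classifiedD: "classified s \<Longrightarrow> q < n \<Longrightarrow> snd s (Suc 0) q = (if forced_hold T q then 1 else 0)"
  by (simp add: classified_def)

lemma wp_walk:
  assumes "0 < m" "i < n" "decoded s" "classified s" "fst s 5 = i" "\<forall>q<i. snd s 5 q = rank q"
  shows "wp (length word) walk (\<lambda>s'. fst s' 5 = i \<and> decoded s' \<and> classified s' \<and>
    (\<forall>q<Suc i. snd s' 5 q = rank q) \<and>
    fst s' 1 = (if \<not> forced_hold T ((hold ^^ n) i) then fst s 1 else 0)) s"
proof -
  define partial where "partial j = (\<Sum>l<j. if forced_hold T ((hold ^^ l) i) then 1 else 0 :: nat)" for j
  define I where "I j s' \<longleftrightarrow> decoded s' \<and> classified s' \<and> fst s' 5 = i \<and>
    (\<forall>q<i. snd s' 5 q = rank q) \<and> snd s' 5 i = partial j \<and>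
    fst s' 10 = (hold ^^ j) i \<and> fst s' 1 = fst s 1" for j s'
  have less: "(hold ^^ j) i < n" for j
    using assms(1,2) by (rule hold_funpow_less)
  have body: "wp (length word) walk_step
      (\<lambda>s''. fst s'' 6 = j \<and> fst s'' 3 = n \<and> I (Suc j) (set_reg 6 (Suc j) s'')) s'"
    if "I j s'" "fst s' 6 = j" "fst s' 3 = n" for j s'
    unfolding walk_step_def
    by (intro wp_intros)
      (use that assms(1,2) less[of j] in \<open>auto simp: I_def partial_def hold_def classifiedD\<close>)
  have loop: "wp (length word) (For 6 3 walk_step) (I n) s'" if "I 0 s'" for s'
    by (rule wp_For[where N = n and I = I])
      (use that body bounds in \<open>auto simp: I_def decoded_regs\<close>)
  have "partial n = rank i" by (simp add: partial_def rank_def)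
  with less[of n] show ?thesis
    unfolding walk_def
    by (intro wp_Seq wp_SetReg wp_SetArr wp_mono[OF loop] wp_Cond wp_Skip)
      (use assms in \<open>auto simp: I_def partial_def classifiedD less_Suc_eq\<close>)
qed

lemma wp_walks:
  assumes "0 < m" "decoded s" "classified s"
  shows "wp (length word) (For 5 3 walk) (\<lambda>s'. decoded s' \<and> classified s' \<and> ranked s' \<and>
    fst s' 1 = (if halting then fst s 1 else 0)) s"
proof (rule wp_For[where N = n and I = "\<lambda>i s'. decoded s' \<and> classified s' \<and>
      (\<forall>q<i. snd s' 5 q = rank q) \<and>
      fst s' 1 = (if \<forall>q<i. \<not> forced_hold T ((hold ^^ n) q) then fst s 1 else 0)"])
  fix i s'
  assume "i < n" "decoded s' \<and> classified s' \<and> (\<forall>q<i. snd s' 5 q = rank q) \<and>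
      fst s' 1 = (if \<forall>q<i. \<not> forced_hold T ((hold ^^ n) q) then fst s 1 else 0)"
    "fst s' 5 = i" "fst s' 3 = n"
  then show "wp (length word) walk (\<lambda>s'. fst s' 5 = i \<and> fst s' 3 = n \<and>
      decoded (set_reg 5 (Suc i) s') \<and> classified (set_reg 5 (Suc i) s') \<and>
      (\<forall>q<Suc i. snd (set_reg 5 (Suc i) s') 5 q = rank q) \<and>
      fst (set_reg 5 (Suc i) s') 1 =
        (if \<forall>q<Suc i. \<not> forced_hold T ((hold ^^ n) q) then fst s 1 else 0)) s'"
    using assms(1) by (intro wp_mono[OF wp_walk[of i s']]) (auto simp: decoded_regs All_less_Suc)
qed (use assms bounds in \<open>auto simp: decoded_regs ranked_def halting_def\<close>)

lemma wp_compare_ranks: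
  assumes "decoded s" "classified s" "ranked s"
  shows "wp (length word) compare_ranks (\<lambda>s'. decoded s' \<and> classified s' \<and> ranked s' \<and>
    fst s' 1 = (if ranks_distinct then fst s 1 else 0)) s"
  unfolding compare_ranks_def
proof (rule wp_For_flag[where N = n and J = "\<lambda>s. decoded s \<and> classified s \<and> ranked s" and
      P = "\<lambda>q. \<forall>q'<n. \<not> (q \<noteq> q' \<and> vis T q = vis T q' \<and> rank q = rank q')"], goal_cases)
  case (7 q s)
  show ?case
  proof (rule wp_For_flag[where N = n and
        J = "\<lambda>s. decoded s \<and> classified s \<and> ranked s \<and> fst s 5 = q" and
        P = "\<lambda>q'. \<not> (q \<noteq> q' \<and> vis T q = vis T q' \<and> rank q = rank q')"], goal_cases)
    case (7 q' s)
    with \<open>q < n\<close> show ?case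
      by (intro wp_intros) (auto simp: ranked_def)
  qed (use 7 bounds in \<open>auto simp: decoded_regs\<close>)
qed (use assms bounds in \<open>auto simp: decoded_regs ranks_distinct_def\<close>)

definition inspected :: "store \<Rightarrow> bool" where
  "inspected s \<longleftrightarrow> decoded s \<and> classified s \<and> ranked s"

lemma wp_inspect:
  "wp (length word) inspect (\<lambda>s. classified s \<and>
     verdict s = (if passes_fiber_inspection {..<k} T then 1 else 0) \<and>
     (passes_fiber_inspection {..<k} T \<longrightarrow> inspected s)) (input_store word)"
proof -
  have main: "wp (length word) (Cond (Less (Const 0) (Reg 4))
      (Seq (SetReg 1 (Const 1)) (Seq (For 5 3 walk) compare_ranks)) (SetReg 1 (Const 0)))
    (\<lambda>s. classified s \<and> verdict s = (if passes_fiber_inspection {..<k} T then 1 else 0) \<and>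
     (passes_fiber_inspection {..<k} T \<longrightarrow> inspected s)) s" if "decoded s" "classified s" for s
  proof (rule wp_Cond)
    assume "bval (Less (Const 0) (Reg 4)) s"
    with that have "0 < m" by (simp add: decoded_regs)
    then show "wp (length word) (Seq (SetReg 1 (Const 1)) (Seq (For 5 3 walk) compare_ranks))
      (\<lambda>s. classified s \<and> verdict s = (if passes_fiber_inspection {..<k} T then 1 else 0) \<and>
       (passes_fiber_inspection {..<k} T \<longrightarrow> inspected s)) s"
      using that
      by (intro wp_Seq wp_SetReg wp_mono[OF wp_walks] wp_mono[OF wp_compare_ranks])
        (auto simp: passes_fiber_inspection_iff verdict_def inspected_def)
  next
    assume "\<not> bval (Less (Const 0) (Reg 4)) s"
    with that have "m = 0" by (simp add: decoded_regs)
    from not_fiber_inspection_if_no_inputs[OF this] that show "wp (length word) (SetReg 1 (Const 0))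
      (\<lambda>s. classified s \<and> verdict s = (if passes_fiber_inspection {..<k} T then 1 else 0) \<and>
       (passes_fiber_inspection {..<k} T \<longrightarrow> inspected s)) s"
      by (intro wp_SetReg) (simp add: verdict_def)
  qed
  show ?thesis
    unfolding inspect_def
    by (intro wp_Seq wp_mono[OF wp_decode] wp_mono[OF wp_classify]) (assumption | erule conjE, rule main)+
qed

definition clash :: "nat \<Rightarrow> nat \<Rightarrow> nat \<Rightarrow> bool" where
  "clash q u v \<longleftrightarrow> \<not> forced_hold T q \<and> vis T (step T q u) = vis T (step T q v) \<and>
     step T q u \<noteq> step T q v"

lemma wp_check:
  assumes "passes_fiber_inspection {..<k} T" "inspected s" "verdict s = 1"
  shows "wp (length word) check (\<lambda>s. inspected s \<and>
    verdict s = (if passes_entry_check E T then 1 else 0)) s"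
  unfolding check_def
proof (rule wp_For_flag[where N = n and J = inspected and
      P = "\<lambda>q. \<forall>u<m. \<forall>v<m. \<not> clash q u v"], goal_cases)
  case (7 q s)
  show ?case
  proof (rule wp_For_flag[where N = m and J = "\<lambda>s. inspected s \<and> fst s 5 = q" and
        P = "\<lambda>u. \<forall>v<m. \<not> clash q u v"], goal_cases)
    case (7 u s)
    show ?case
    proof (rule wp_For_flag[where N = m and J = "\<lambda>s. inspected s \<and> fst s 5 = q \<and> fst s 6 = u" and
          P = "\<lambda>v. \<not> clash q u v"], goal_cases)
      case (7 v s)
      with \<open>q < n\<close> \<open>u < m\<close> show ?case
        unfolding check_pair_def
        by (intro wp_intros) (auto simp: inspected_def clash_def classifiedD)
    qed (use 7 bounds in \<open>auto simp: decoded_regs inspected_def\<close>)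
  qed (use 7 bounds in \<open>auto simp: decoded_regs inspected_def\<close>)
next
  case (8 s')
  then show ?case
    using assms passes_entry_check_iff[OF assms(1)] by (simp add: verdict_def clash_def)
qed (use assms bounds in \<open>auto simp: decoded_regs inspected_def\<close>)

definition decision_state :: "nat \<Rightarrow> nat" where
  "decision_state i = (THE q. q \<in> Fib T i \<and> decision T q)"

definition entry_rank :: "nat \<Rightarrow> nat \<Rightarrow> nat" where
  "entry_rank i j =
     (if \<exists>u<m. vis T (step T (decision_state i) u) = j
      then rank (step T (decision_state i)
        (SOME u. u < m \<and> vis T (step T (decision_state i) u) = j))
      else 0)"

definition reconstruction :: "(nat, nat, nat) dlsl" where
  "reconstruction =
     \<lparr> verts = {..<k}, edges = E, label = (\<lambda>i. i), start = vis T (init T),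
       dwell = (\<lambda>i. card (Fib T i)), entry = entry_rank,
       choice = (\<lambda>i u. vis T (step T (decision_state i) u)) \<rparr>"

end

locale consistent = respecting +
  assumes inspection: "passes_fiber_inspection {..<k} T"
    and entry_check: "passes_entry_check E T"
begin

lemma m_pos: "0 < m"
  using inspection not_fiber_inspection_if_no_inputs by blast

lemma walks_halt: halting and ranks_differ: ranks_distinct
  using inspection passes_fiber_inspection_iff[OF m_pos] by auto

lemmas rank_Fib = rank_image_Fib[OF m_pos walks_halt ranks_differ]

lemma rank_less: "q < n \<Longrightarrow> rank q < card (Fib T (vis T q))"
  using rank_Fib(1)[of "vis T q"] by (auto simp: mem_Fib_iff)

lemma decision_state:
  assumes "i < k"
  shows "decision_state i < n" "vis T (decision_state i) = i"
    "\<not> forced_hold T (decision_state i)"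
    "\<And>q. q < n \<Longrightarrow> vis T q = i \<Longrightarrow> \<not> forced_hold T q \<Longrightarrow> decision_state i = q"
proof -
  obtain p where p: "{q \<in> Fib T i. decision T q} = {p}"
    using inspection assms unfolding passes_fiber_inspection_def path_fiber_at_def by blast
  then have eq: "q \<in> Fib T i \<and> decision T q \<longleftrightarrow> q = p" for q by blast
  then have p: "decision_state i = p"
    unfolding decision_state_def by simp
  from eq[of p] show "decision_state i < n" "vis T (decision_state i) = i"
    "\<not> forced_hold T (decision_state i)"
    unfolding p by (simp_all add: mem_Fib_iff decision_def)
  show "decision_state i = q" if "q < n" "vis T q = i" "\<not> forced_hold T q" for q
    using eq[of q] that p by (simp add: mem_Fib_iff decision_def)
qed

lemma entry_rank_eq:
  assumes "i < k" "u < m" "vis T (step T (decision_state i) u) = j"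
  shows "entry_rank i j = rank (step T (decision_state i) u)"
proof -
  let ?P = "\<lambda>u. u < m \<and> vis T (step T (decision_state i) u) = j"
  define v where "v = (SOME u. ?P u)"
  have v: "?P v" unfolding v_def using assms by (intro someI[of ?P u]) simp
  have "step T (decision_state i) v = step T (decision_state i) u"
    using passes_entry_check_iff[OF inspection] entry_check decision_state(1,3)[OF assms(1)]
      v assms(2,3) by metis
  moreover have "entry_rank i j = rank (step T (decision_state i) v)"
    using assms(2,3) unfolding entry_rank_def v_def by auto
  ultimately show ?thesis by simp
qed

lemma entry_rank_eq_0: "(\<And>u. u < m \<Longrightarrow> vis T (step T (decision_state i) u) \<noteq> j) \<Longrightarrow> entry_rank i j = 0"
  by (auto simp: entry_rank_def)

lemma entry_rank_non_edge: "i < k \<Longrightarrow> (i, j) \<notin> E \<Longrightarrow> entry_rank i j = 0"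
  using vis_step[of "decision_state i"] decision_state(1,2)[of i]
  by (intro entry_rank_eq_0) auto

lemma edge_entry_reconstruction: "edge_entry_dlsl {..<m} reconstruction"
proof -
  have "entry_rank i j \<le> card (Fib T j) - 1" if "(i, j) \<in> E" for i j
  proof (cases "\<exists>u<m. vis T (step T (decision_state i) u) = j")
    case True
    then obtain u where u: "u < m" "vis T (step T (decision_state i) u) = j" by blast
    have "i < k" using that edges_subset by auto
    with u have "entry_rank i j < card (Fib T j)"
      using entry_rank_eq[of i u j] rank_less[of "step T (decision_state i) u"]
        decision_state(1)[of i] by simp
    then show ?thesis by simp
  qed (auto intro: entry_rank_eq_0 simp: entry_rank_def)
  moreover have "vis T (step T (decision_state i) u) \<in> E `` {i}" if "i < k" "u < m" for i u
    using vis_step[of "decision_state i" u] decision_state(1,2)[of i] that by simp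
  moreover have "1 \<le> card (Fib T i)" if "i < k" for i
    using Fib_nonempty[OF that] by (auto simp: Suc_le_eq card_gt_0_iff)
  ultimately show ?thesis
    using looping by (auto simp: edge_entry_dlsl_def reconstruction_def label_deterministic_def)
qed

lemma rank_step:
  assumes "q < n" "u < m"
  shows "update reconstruction (vis T q, rank q) u = (vis T (step T q u), rank (step T q u))"
proof (cases "forced_hold T q")
  case True
  then have "step T q u = step T q 0" "vis T (step T q u) = vis T q"
    using assms forced_hold_iff[OF assms(1)] by blast+
  with True have "step T q u = hold q" "vis T (step T q u) = vis T q"
    by (simp_all add: hold_def)
  moreover have "rank q = Suc (rank (hold q))"
    using rank_forced walks_halt assms(1) True by blast
  ultimately show ?thesis by simp
next
  case False
  then have q: "decision_state (vis T q) = q" using assms decision_state(4) by simp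
  let ?j = "vis T (step T q u)"
  have "dest reconstruction (vis T q) (choice reconstruction (vis T q) u) = ?j"
    using vis_step[OF assms] by (auto simp: dest_def reconstruction_def q)
  moreover have "entry reconstruction (vis T q) ?j = rank (step T q u)"
    using entry_rank_eq[of "vis T q" u ?j] assms by (simp add: reconstruction_def q)
  ultimately show ?thesis using rank_decision[OF False] by simp
qed

lemma iso_reconstruction: "transducer_iso (realization {..<m} reconstruction) T"
proof (rule transducer_iso_sym)
  let ?\<Psi> = "\<lambda>q. (vis T q, rank q)"
  let ?R = "realization {..<m} reconstruction"
  have R: "states ?R = {(i, r). i < k \<and> r \<le> card (Fib T i) - 1}"
    by (simp add: realization_def reconstruction_def)
  have "inj_on ?\<Psi> {..<n}"
    using ranks_differ unfolding ranks_distinct_def inj_on_def by blast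
  moreover have "?\<Psi> ` {..<n} = states ?R"
  proof (intro equalityI subsetI)
    fix x assume "x \<in> ?\<Psi> ` {..<n}"
    then obtain q where "x = ?\<Psi> q" "q < n" by auto
    with rank_less[of q] show "x \<in> states ?R" by (auto simp: R)
  next
    fix x assume "x \<in> states ?R"
    then obtain i r where x: "x = (i, r)" "i < k" "r \<le> card (Fib T i) - 1" by (auto simp: R)
    have "card (Fib T i) > 0"
      using Fib_nonempty[OF \<open>i < k\<close>] by (auto simp: card_gt_0_iff)
    with x have "r \<in> rank ` Fib T i" by (auto simp: rank_Fib(1))
    with x show "x \<in> ?\<Psi> ` {..<n}" by (auto simp: mem_Fib_iff)
  qed
  ultimately have "bij_betw ?\<Psi> (states T) (states ?R)"
    by (simp add: bij_betw_def)
  then show "transducer_iso T ?R"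
    unfolding transducer_iso_def using rank_step
    by (intro conjI exI[of _ ?\<Psi>]) (simp_all add: realization_def)
qed simp

definition prepared :: "nat list \<Rightarrow> store \<Rightarrow> bool" where
  "prepared ys s \<longleftrightarrow> inspected s \<and> (\<forall>i<k. snd s 6 i = decision_state i) \<and> output_word s = ys"

lemma prepared_set_reg [simp]:
  "x \<notin> {0, 2, 3, 4} \<Longrightarrow> prepared ys (set_reg x v s) = prepared ys s"
  by (simp add: prepared_def inspected_def)

lemma preparedD:
  assumes "prepared ys s"
  shows "decoded s" "ranked s" "output_word s = ys" "\<And>i. i < k \<Longrightarrow> snd s 6 i = decision_state i"
  using assms by (auto simp: prepared_def inspected_def)

lemma prepared_regs:
  assumes "prepared ys s"
  shows "fst s 2 = k" "fst s 3 = n" "fst s 4 = m"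
  using preparedD(1)[OF assms] by (simp_all add: decoded_regs)

lemma wp_find_decisions:
  assumes "inspected s"
  shows "wp (length word) find_decisions
    (\<lambda>s. inspected s \<and> (\<forall>i<k. snd s 6 i = decision_state i)) s"
  unfolding find_decisions_def
proof (rule wp_For[where N = n and I = "\<lambda>i s. inspected s \<and>
      (\<forall>q<i. \<not> forced_hold T q \<longrightarrow> snd s 6 (vis T q) = q)"], goal_cases)
  case (5 i s)
  have "forced_hold T q" if "q < i" "\<not> forced_hold T i" "vis T q = vis T i" for q
    using that 5(1) decision_state(4)[of "vis T i"] by (metis vis_less less_trans less_irrefl)
  with 5 show ?case
    by (intro wp_intros) (auto simp: inspected_def decoded_regs classifiedD less_Suc_eq split: if_splits)
next
  case (6 s)
  have "snd s 6 i = decision_state i" if "i < k" for i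
    using 6 decision_state(1-3)[OF that] by metis
  with 6 show ?case by simp
qed (use assms bounds in \<open>auto simp: decoded_regs inspected_def\<close>)

lemma wp_emit_prepared:
  assumes "prepared ys s" "aval e s = v"
  shows "wp (length word) (emit e) (\<lambda>s'. prepared (ys @ [v]) s' \<and> (\<forall>x. x \<noteq> 0 \<longrightarrow> fst s' x = fst s x)) s"
  by (rule wp_emit) (use assms in \<open>auto simp: prepared_def inspected_def\<close>)

lemma wp_emit_list:
  assumes "prepared ys s"
    and "\<And>i s zs. i < k \<Longrightarrow> prepared zs s \<Longrightarrow> fst s 5 = i \<Longrightarrow>
      wp (length word) c (\<lambda>s'. prepared (zs @ f i) s' \<and> fst s' 5 = i) s"
  shows "wp (length word) (For 5 2 c) (prepared (ys @ concat (map f [0..<k]))) s"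
proof (rule wp_For[where N = k and I = "\<lambda>i. prepared (ys @ concat (map f [0..<i]))"], goal_cases)
  case (5 i s)
  show ?case
  proof (rule wp_mono[OF assms(2)[of i "ys @ concat (map f [0..<i])" s]], goal_cases)
    case (4 s')
    then have "prepared (ys @ concat (map f [0..<Suc i])) s'" by simp
    with 4 prepared_regs(1)[OF this] show ?case by simp
  qed (use 5 in auto)
qed (use assms(1) bounds in \<open>simp_all add: prepared_regs\<close>)

lemma wp_emit_table:
  assumes "prepared ys s" "(y = 2 \<and> N = k) \<or> (y = 4 \<and> N = m)"
    and "\<And>i j s zs. i < k \<Longrightarrow> j < N \<Longrightarrow> prepared zs s \<Longrightarrow> fst s 5 = i \<Longrightarrow> fst s 6 = j \<Longrightarrow>
      wp (length word) c (\<lambda>s'. prepared (zs @ [f i j]) s' \<and> fst s' 5 = i \<and> fst s' 6 = j) s"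
  shows "wp (length word) (For 5 2 (For 6 y c)) (prepared (ys @ table k N f)) s"
  unfolding table_def
proof (rule wp_emit_list[OF assms(1)])
  have y: "fst s y = N" if "prepared zs s" for zs s
    using assms(2) prepared_regs[OF that] by metis
  fix i s zs
  assume i: "i < k" "prepared zs s" "fst s 5 = i"
  show "wp (length word) (For 6 y c) (\<lambda>s'. prepared (zs @ map (f i) [0..<N]) s' \<and> fst s' 5 = i) s"
  proof (rule wp_For[where N = N and
        I = "\<lambda>j s'. prepared (zs @ map (f i) [0..<j]) s' \<and> fst s' 5 = i"], goal_cases)
    case (5 j s)
    then show ?case using i(1) by (intro wp_mono[OF assms(3)[of i j]]) (auto dest: y)
  qed (use assms(2) bounds i y in auto)
qed

lemma wp_emit_dwell:
  assumes "prepared zs s" "fst s 5 = i"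
  shows "wp (length word) emit_dwell (\<lambda>s'. prepared (zs @ [card (Fib T i)]) s' \<and> fst s' 5 = i) s"
proof -
  define count where "count j = (\<Sum>q<j. if vis T q = i then 1 else 0 :: nat)" for j
  define I where "I j s' \<longleftrightarrow> prepared zs s' \<and> fst s' 5 = i \<and> fst s' 11 = count j" for j s'
  have loop: "wp (length word)
      (For 6 3 (Cond (Eq (vis_at (Reg 6)) (Reg 5)) (SetReg 11 (Plus (Reg 11) (Const 1))) Skip))
      (I n) s'" if "I 0 s'" for s'
  proof (rule wp_For[where N = n and I = I], goal_cases)
    case (5 q s')
    then have p: "prepared zs s'" by (simp add: I_def)
    from 5 preparedD(1)[OF p] show ?case
      by (intro wp_intros) (auto simp: I_def count_def)
  qed (use that bounds prepared_regs[of zs s'] in \<open>simp_all add: I_def\<close>)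
  have "count n = card (Fib T i)"
    by (simp add: count_def sum.If_cases Fib_def Int_def)
  then have emit: "wp (length word) (emit (Reg 11))
      (\<lambda>s'. prepared (zs @ [card (Fib T i)]) s' \<and> fst s' 5 = i) s'" if "I n s'" for s'
    using that by (intro wp_mono[OF wp_emit_prepared]) (auto simp: I_def)
  show ?thesis
    unfolding emit_dwell_def
    by (intro wp_Seq wp_SetReg wp_mono[OF loop] emit) (use assms in \<open>simp_all add: I_def count_def\<close>)
qed

lemma wp_emit_entry:
  assumes "i < k" "prepared zs s" "fst s 5 = i" "fst s 6 = j"
  shows "wp (length word) emit_entry
    (\<lambda>s'. prepared (zs @ [entry_rank i j]) s' \<and> fst s' 5 = i \<and> fst s' 6 = j) s"
proof -
  let ?d = "decision_state i"
  define I where "I u s' \<longleftrightarrow> prepared zs s' \<and> fst s' 5 = i \<and> fst s' 6 = j \<and>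
    fst s' 11 = (if \<exists>v<u. vis T (step T ?d v) = j then entry_rank i j else 0)" for u s'
  have loop: "wp (length word)
      (For 7 4 (Cond (Eq (vis_at (step_at (Arr 6 (Reg 5)) (Reg 7))) (Reg 6))
        (SetReg 11 (Arr 5 (step_at (Arr 6 (Reg 5)) (Reg 7)))) Skip)) (I m) s'" if "I 0 s'" for s'
  proof (rule wp_For[where N = m and I = I], goal_cases)
    case (5 u s')
    then have p: "prepared zs s'" by (simp add: I_def)
    note s' = preparedD(1,2)[OF p] preparedD(4)[OF p assms(1)]
    have "?d < n" using decision_state(1) assms(1) by simp
    with 5 s' assms(1) show ?case
      by (intro wp_intros) (auto simp: I_def decoded_regs ranked_def entry_rank_eq less_Suc_eq)
  qed (use that bounds prepared_regs[of zs s'] in \<open>simp_all add: I_def\<close>)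
  have "(if \<exists>v<m. vis T (step T ?d v) = j then entry_rank i j else 0) = entry_rank i j"
    using entry_rank_eq_0[of i j] by auto
  then have emit: "wp (length word) (emit (Reg 11))
      (\<lambda>s'. prepared (zs @ [entry_rank i j]) s' \<and> fst s' 5 = i \<and> fst s' 6 = j) s'" if "I m s'" for s'
    using that unfolding I_def by (intro wp_mono[OF wp_emit_prepared]) auto
  show ?thesis
    unfolding emit_entry_def
    by (intro wp_Seq wp_SetReg wp_mono[OF loop] emit) (use assms in \<open>simp_all add: I_def\<close>)
qed

lemma wp_build:
  assumes "inspected s"
  shows "wp (length word) build (\<lambda>s. output_word s = 1 # encode_dlsl k m reconstruction) s"
proof -
  have start: "prepared [] (set_reg 0 0 s)"
    if "inspected s \<and> (\<forall>i<k. snd s 6 i = decision_state i)" for s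
    using that by (simp add: prepared_def inspected_def output_word_def)
  have const: "wp (length word) (emit e) (prepared (ys @ [v])) s"
    if "prepared ys s" "aval e s = v" for e ys v s
    using wp_emit_prepared[OF that] by (rule wp_mono) simp
  have labels: "wp (length word) (For 5 2 (emit (Reg 5))) (prepared (ys @ map (\<lambda>i. i) [0..<k])) s"
    if "prepared ys s" for ys s
  proof -
    have "wp (length word) (For 5 2 (emit (Reg 5))) (prepared (ys @ concat (map (\<lambda>i. [i]) [0..<k]))) s"
      by (rule wp_emit_list[OF that]) (auto intro!: wp_mono[OF wp_emit_prepared])
    then show ?thesis by simp
  qed
  have dwells: "wp (length word) (For 5 2 emit_dwell)
      (prepared (ys @ map (\<lambda>i. card (Fib T i)) [0..<k])) s" if "prepared ys s" for ys s
  proof -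
    have "wp (length word) (For 5 2 emit_dwell)
        (prepared (ys @ concat (map (\<lambda>i. [card (Fib T i)]) [0..<k]))) s"
      by (rule wp_emit_list[OF that]) (auto intro: wp_emit_dwell)
    then show ?thesis by simp
  qed
  have edges: "wp (length word) (For 5 2 (For 6 2 (emit (edge_at (Reg 5) (Reg 6)))))
      (prepared (ys @ table k k (\<lambda>i j. if (i, j) \<in> E then 1 else 0))) s" if "prepared ys s" for ys s
    by (rule wp_emit_table[OF that])
      (auto intro!: wp_mono[OF wp_emit_prepared] simp: preparedD(1))
  have entries: "wp (length word) (For 5 2 (For 6 2 emit_entry))
      (prepared (ys @ table k k entry_rank)) s" if "prepared ys s" for ys s
    by (rule wp_emit_table[OF that]) (auto intro: wp_emit_entry)
  have choices: "wp (length word) (For 5 2 (For 6 4 (emit (vis_at (step_at (Arr 6 (Reg 5)) (Reg 6))))))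
      (prepared (ys @ table k m (\<lambda>i u. vis T (step T (decision_state i) u)))) s"
    if "prepared ys s" for ys s
  proof (rule wp_emit_table[OF that], goal_cases)
    case (2 i u s zs)
    with preparedD(1)[OF 2(3)] preparedD(4)[OF 2(3,1)] decision_state(1)[OF 2(1)] show ?case
      by (intro wp_mono[OF wp_emit_prepared[OF 2(3)]]) auto
  qed simp
  have header: "aval (Const 1) s = 1" "aval (Reg 2) s = k" "aval (Reg 4) s = m"
      "aval (vis_at (Arr 2 (Const 3))) s = vis T (init T)" if "prepared ys s" for ys s
    using preparedD(1)[OF that] prepared_regs[OF that] by (simp_all add: decoded_def)
  have entry_table: "table k k entry_rank = table k k (\<lambda>i j. if (i, j) \<in> E then entry_rank i j else 0)"
    by (intro table_cong) (simp add: entry_rank_non_edge)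
  have "wp (length word) build (\<lambda>s. prepared (((((((([] @ [1]) @ [k]) @ [m]) @ [vis T (init T)]) @
      map (\<lambda>i. i) [0..<k]) @ map (\<lambda>i. card (Fib T i)) [0..<k]) @
      table k k (\<lambda>i j. if (i, j) \<in> E then 1 else 0)) @ table k k entry_rank @
      table k m (\<lambda>i u. vis T (step T (decision_state i) u))) s) s"
    unfolding build_def append_assoc[symmetric]
    by (rule wp_Seq_mono[OF wp_find_decisions[OF assms]], rule wp_Seq, rule wp_SetReg,
        simp only: aval.simps, drule start, (rule wp_Seq_mono[OF const], assumption, erule header)+,
        (rule wp_Seq_mono, erule labels dwells edges entries)+, erule choices)
  then show ?thesis
    by (rule wp_mono) (simp add: preparedD(3) encode_dlsl_def reconstruction_def entry_table cong: if_cong)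
qed

end

lemma wp_reject: "wp L reject (\<lambda>s. output_word s = [0]) s"
  unfolding reject_def by (intro wp_intros) (simp add: output_word_def)

lemma (in respecting) wp_recognizer:
  "wp (length word) (recognizer inspect check build)
     (\<lambda>s. output_word s = (if entry_consistent_path_fiber {..<k} E T
        then 1 # encode_dlsl k m reconstruction else [0])) (input_store word)"
proof -
  let ?Q = "\<lambda>s. output_word s = (if entry_consistent_path_fiber {..<k} E T
    then 1 # encode_dlsl k m reconstruction else [0])"
  have reject: "wp (length word) reject ?Q s" if "\<not> entry_consistent_path_fiber {..<k} E T" for s
    using that by (simp add: wp_reject)
  have build: "wp (length word) build ?Q s"
    if "passes_fiber_inspection {..<k} T" "passes_entry_check E T" "inspected s" for s
  proof -
    interpret consistent k n m E T using that by unfold_locales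
    show ?thesis using wp_build[OF that(3)] that by (simp add: entry_consistent_path_fiber_iff)
  qed
  have verdict: "wp (length word) (Cond (Eq (Reg 1) (Const 1)) c reject) ?Q s"
    if "verdict s = (if b then 1 else 0)" "b \<Longrightarrow> wp (length word) c ?Q s"
      "\<not> b \<Longrightarrow> \<not> entry_consistent_path_fiber {..<k} E T" for b c s
  proof (rule wp_Cond)
    assume "bval (Eq (Reg 1) (Const 1)) s"
    with that(1) have b by (cases b) (simp_all add: verdict_def)
    then show "wp (length word) c ?Q s" by (rule that(2))
  next
    assume "\<not> bval (Eq (Reg 1) (Const 1)) s"
    with that(1) have "\<not> b" by (cases b) (simp_all add: verdict_def)
    then show "wp (length word) reject ?Q s" by (intro reject that(3))
  qed
  have check: "wp (length word) (Seq check (Cond (Eq (Reg 1) (Const 1)) build reject)) ?Q s"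
    if "passes_fiber_inspection {..<k} T" "inspected s" "verdict s = 1" for s
  proof (rule wp_Seq_mono[OF wp_check[OF that]], rule verdict[where b = "passes_entry_check E T"],
      goal_cases)
    case (1 s)
    then show ?case by (rule conjunct2)
  next
    case (2 s)
    from 2(1) have "inspected s" by (rule conjunct1)
    with that(1) 2(2) show ?case by (rule build)
  next
    case (3 s)
    then show ?case by (simp add: entry_consistent_path_fiber_iff)
  qed
  show ?thesis
    unfolding recognizer_def
  proof (rule wp_Seq_mono[OF wp_inspect],
      rule verdict[where b = "passes_fiber_inspection {..<k} T"], goal_cases)
    case (1 s)
    then show ?case by blast
  next
    case (2 s)
    then have "inspected s" "verdict s = 1" by simp_all
    from 2(2) this show ?case by (rule check)
  next
    case (3 s)
    then show ?case by (simp add: entry_consistent_path_fiber_iff)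
  qed
qed

theorem corollary7p4:
  shows "\<exists>(inspect :: com) (check :: com) (build :: com) (P :: nat poly).
    \<forall>(k :: nat) (n :: nat) (m :: nat) (E :: (nat \<times> nat) set) (T :: (nat, nat, nat) transducer).
      self_looping_graph {..<k} E \<and> graph_respecting {..<k} E T \<and> accessible T \<and>
      states T = {..<n} \<and> inputs T = {..<m} \<longrightarrow>
      (\<exists>t s. exec inspect (input_store (encode_instance k n m E T)) t s \<and>
         (\<forall>q\<in>states T. classification s q = (if forced_hold T q then 1 else 0)) \<and>
         verdict s = (if passes_fiber_inspection {..<k} T then 1 else 0) \<and>
         (passes_fiber_inspection {..<k} T \<longrightarrow>
            (\<exists>t' s'. exec check s t' s' \<and>
               verdict s' = (if passes_entry_check E T then 1 else 0)))) \<and>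
      (\<exists>t s. exec (recognizer inspect check build) (input_store (encode_instance k n m E T)) t s \<and>
         t \<le> poly P (length (encode_instance k n m E T)) \<and>
         (if entry_consistent_path_fiber {..<k} E T
          then \<exists>A :: (nat, nat, nat) dlsl.
                 edge_entry_dlsl {..<m} A \<and> verts A = {..<k} \<and> edges A = E \<and>
                 output_word s = 1 # encode_dlsl k m A \<and>
                 transducer_iso (realization {..<m} A) T
          else output_word s = [0]))"
proof (rule exI[of _ inspect], rule exI[of _ check], rule exI[of _ build],
    rule exI[of _ "cost (recognizer inspect check build)"], intro allI impI)
  fix k n m :: nat and E :: "(nat \<times> nat) set" and T :: "(nat, nat, nat) transducer"
  assume "self_looping_graph {..<k} E \<and> graph_respecting {..<k} E T \<and> accessible T \<and>
    states T = {..<n} \<and> inputs T = {..<m}"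
  then interpret respecting k n m E T by unfold_locales auto
  let ?w = "encode_instance k n m E T"
  let ?fiber = "passes_fiber_inspection {..<k} T"
  show "(\<exists>t s. exec inspect (input_store ?w) t s \<and>
       (\<forall>q\<in>states T. classification s q = (if forced_hold T q then 1 else 0)) \<and>
       verdict s = (if ?fiber then 1 else 0) \<and>
       (?fiber \<longrightarrow> (\<exists>t' s'. exec check s t' s' \<and>
          verdict s' = (if passes_entry_check E T then 1 else 0)))) \<and>
    (\<exists>t s. exec (recognizer inspect check build) (input_store ?w) t s \<and>
       t \<le> poly (cost (recognizer inspect check build)) (length ?w) \<and>
       (if entry_consistent_path_fiber {..<k} E T
        then \<exists>A :: (nat, nat, nat) dlsl.
               edge_entry_dlsl {..<m} A \<and> verts A = {..<k} \<and> edges A = E \<and>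
               output_word s = 1 # encode_dlsl k m A \<and>
               transducer_iso (realization {..<m} A) T
        else output_word s = [0]))" (is "?tests \<and> ?recognition")
  proof
    from wp_inspect obtain t s where s: "exec inspect (input_store ?w) t s" "classified s"
        "verdict s = (if ?fiber then 1 else 0)" "?fiber \<longrightarrow> inspected s"
      unfolding wp_def by blast
    have "\<exists>t' s'. exec check s t' s' \<and> verdict s' = (if passes_entry_check E T then 1 else 0)"
      if ?fiber
    proof -
      have "inspected s" "verdict s = 1" using s(3,4) that by simp_all
      from wp_check[OF that this] show ?thesis unfolding wp_def by blast
    qed
    moreover have "\<forall>q\<in>states T. classification s q = (if forced_hold T q then 1 else 0)"
      using s(2) by (simp add: classified_def classification_def)
    ultimately show ?tests using s(1,3) by blast
  next
    from wp_recognizer obtain t s where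
      s: "exec (recognizer inspect check build) (input_store ?w) t s"
        "t \<le> poly (cost (recognizer inspect check build)) (length ?w)"
        "output_word s = (if entry_consistent_path_fiber {..<k} E T
          then 1 # encode_dlsl k m reconstruction else [0])"
      unfolding wp_def by blast
    have "if entry_consistent_path_fiber {..<k} E T
      then \<exists>A :: (nat, nat, nat) dlsl.
             edge_entry_dlsl {..<m} A \<and> verts A = {..<k} \<and> edges A = E \<and>
             output_word s = 1 # encode_dlsl k m A \<and>
             transducer_iso (realization {..<m} A) T
      else output_word s = [0]"
    proof (cases "entry_consistent_path_fiber {..<k} E T")
      case True
      then interpret consistent k n m E T
        by unfold_locales (simp_all add: entry_consistent_path_fiber_iff)
      have "verts reconstruction = {..<k}" "edges reconstruction = E"
        by (simp_all add: reconstruction_def)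
      with True edge_entry_reconstruction iso_reconstruction s(3) show ?thesis
        unfolding if_P[OF True] by blast
    next
      case False
      with s(3) show ?thesis by simp
    qed
    with s(1,2) show ?recognition by blast
  qed
qed

end
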